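(* Let $\mathcal Z_\theta\subset\mathbb R^d$ be a (nonempty, closed) convex set, let $\sigma>0$, and let the distance be defined using the Euclidean norm, $\operatorname{dist}(y,\mathcal Z_\theta)=\min_{z\in\mathcal Z_\theta}\|y-z\|_2$. Let $$m_{\theta,\sigma}=\int_{t>0} e^{-t^2/\sigma}\,A(S_{\theta,t})\,dt$$ be the normalizing constant, where $A(S_{\theta,t})$ is the area of the level set $S_{\theta,t}=\{y:\operatorname{dist}(y,\mathcal Z_\theta)=t\}$. Then the normalizing constant admits the form $$m_{\theta,\sigma}=\sum_{k=0}^{d-1}\pi^{(d-k)/2}\,V_k(\mathcal Z_\theta)\,\sigma^{(d-k)/2},$$ where $V_k(\mathcal Z_\theta)>0$ is the $k$-th dimensional volume for $\mathcal Z_\theta$. For bounded $\mathcal Z_\theta$ with non-empty interior, $V_k(\mathcal Z_\theta)\in(0,\infty)$ for all $k=0,1,\ldots,d-1$.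
   Context: For $t>0$, let $\mathcal Z_\theta^t=\{z+v: z\in\mathcal Z_\theta,\ \|v\|_2\le t\}$ be the closed $t$-neighborhood of $\mathcal Z_\theta$, with $d$-dimensional volume $V(\mathcal Z_\theta^t)$. The level set $S_{\theta,t}$ is the boundary of $\mathcal Z_\theta^t$, and its area is $A(S_{\theta,t})=\partial V(\mathcal Z_\theta^t)/\partial t$. The $k$-th dimensional volumes $V_k(\mathcal Z_\theta)$ are the quantities (intrinsic volumes) appearing in the Steiner formula $$V(\mathcal Z_\theta^t)=\sum_{k=0}^{d}\kappa_{d-k}\,V_k(\mathcal Z_\theta)\,t^{d-k},\qquad t>0,\qquad \kappa_j=\frac{\pi^{j/2}}{\Gamma(j/2+1)},$$ where $\kappa_j$ is the $j$-dimensional volume of the unit Euclidean ball. The constant $m_{\theta,\sigma}$ is the normalizing constant in the Gaussian distance kernel likelihood $m_{\theta,\sigma}^{-1}\exp(-\operatorname{dist}^2(y,\mathcal Z_\theta)/\sigma)$ for an observation $y\in\mathbb R^d$.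
   Formalization: V_k>0 is claimed only for k ≤ dim Z (a point has V_1=0). For unbounded Z, where V(Z^t)=∞, V_k is the supremum over compact convex subsets and A uses shell volumes; the identity excludes Z=R^d and unbounded Z with d=1, where it fails (e.g. [0,∞): m=√(πσ)/2, right side √(πσ)). *)

theory Defs
  imports "HOL-Analysis.Analysis"
begin

definition closed_nbhd :: "'a::euclidean_space set \<Rightarrow> real \<Rightarrow> 'a set"
  where "closed_nbhd Z t = {z + v | z v. z \<in> Z \<and> norm v \<le> t}"

lemma closed_nbhd_eq_infdist:
  fixes Z :: "'a::euclidean_space set"
  assumes "closed Z" and "Z \<noteq> {}"
  shows "closed_nbhd Z t = {y. infdist y Z \<le> t}"
proof (intro equalityI subsetI)
  fix y assume "y \<in> closed_nbhd Z t"
  then obtain z v where "y = z + v" "z \<in> Z" "norm v \<le> t"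
    unfolding closed_nbhd_def by blast
  then have "infdist y Z \<le> dist y z" "dist y z \<le> t"
    using infdist_le[of z Z y] by (auto simp: dist_norm)
  then show "y \<in> {y. infdist y Z \<le> t}" by simp
next
  fix y assume y: "y \<in> {y. infdist y Z \<le> t}"
  obtain z where z: "z \<in> Z" "infdist y Z = dist y z"
    using infdist_attains_inf[OF assms] by blast
  have "y = z + (y - z)" "norm (y - z) \<le> t"
    using y z by (auto simp: dist_norm)
  then show "y \<in> closed_nbhd Z t"
    unfolding closed_nbhd_def using z by blast
qed

lemma frontier_closed_nbhd:
  fixes Z :: "'a::euclidean_space set"
  assumes Z: "closed Z" "Z \<noteq> {}" "convex Z" and t: "t > 0"
  shows "frontier (closed_nbhd Z t) = {y. infdist y Z = t}"
proof -
  let ?N = "closed_nbhd Z t"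
  have N: "?N = {y. infdist y Z \<le> t}"
    using Z by (intro closed_nbhd_eq_infdist)
  have cont: "continuous_on UNIV (\<lambda>y. infdist y Z)"
    by (intro continuous_intros)
  have clN: "closed ?N"
    unfolding N by (intro closed_Collect_le cont continuous_intros)
  have opn: "open {y. infdist y Z < t}"
    by (intro open_Collect_less cont continuous_intros)
  have 1: "{y. infdist y Z < t} \<subseteq> interior ?N"
    using opn by (intro interior_maximal) (auto simp: N)
  have 2: "y \<notin> interior ?N" if y: "infdist y Z = t" for y
  proof
    assume "y \<in> interior ?N"
    then obtain e where e: "e > 0" "cball y e \<subseteq> ?N"
      by (auto simp: mem_interior_cball)
    obtain z where z: "z \<in> Z" "infdist y Z = dist y z"
      using infdist_attains_inf[OF Z(1,2)] by blast
    define l where "l = e / t"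
    define x where "x = y + l *\<^sub>R (y - z)"
    have l: "l > 0" using e t by (simp add: l_def)
    have nyz: "norm (y - z) = t" using z y by (simp add: dist_norm)
    have "dist y x = e" using nyz t e by (simp add: x_def dist_norm l_def)
    then have "x \<in> ?N" using e by auto
    then have "infdist x Z \<le> t" by (simp only: N mem_Collect_eq)
    moreover obtain w where "w \<in> Z" "infdist x Z = dist x w"
      using infdist_attains_inf[OF Z(1,2), of x] by blast
    ultimately have w: "w \<in> Z" "dist x w \<le> t" by simp_all
    define p where "p = (l / (1 + l)) *\<^sub>R z + (1 / (1 + l)) *\<^sub>R w"
    have "p \<in> Z" unfolding p_def
      by (rule convexD[OF Z(3) z(1) w(1)]) (use l in \<open>simp_all add: add_divide_distrib[symmetric]\<close>)
    have "y - p = (1 / (1 + l)) *\<^sub>R (x - w)"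
    proof -
      have "(1 + l) *\<^sub>R (y - p) = (1 + l) *\<^sub>R y - (l *\<^sub>R z + w)"
        using l by (simp add: p_def scaleR_diff_right scaleR_add_right)
      also have "\<dots> = x - w"
        by (simp add: x_def algebra_simps)
      finally have "(1 / (1 + l)) *\<^sub>R ((1 + l) *\<^sub>R (y - p)) = (1 / (1 + l)) *\<^sub>R (x - w)"
        by (rule arg_cong)
      then show ?thesis using l by (simp only: scaleR_scaleR) simp
    qed
    then have "dist y p = (1 / (1 + l)) * dist x w"
      using l by (simp add: dist_norm)
    also have "\<dots> \<le> (1 / (1 + l)) * t"
      using w l by (intro mult_left_mono) auto
    also have "\<dots> < t" using t l by (simp add: field_simps)
    finally show False using infdist_le[OF \<open>p \<in> Z\<close>, of y] y by simp
  qed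
  have "interior ?N = {y. infdist y Z < t}"
  proof (intro equalityI 1 subsetI)
    fix y assume y: "y \<in> interior ?N"
    have "y \<in> ?N" using y interior_subset by (rule subsetD[rotated])
    then have "infdist y Z \<le> t" by (simp only: N mem_Collect_eq)
    moreover have "infdist y Z \<noteq> t" using 2 y by blast
    ultimately show "y \<in> {y. infdist y Z < t}" by simp
  qed
  then have "frontier ?N = {y. infdist y Z \<le> t} - {y. infdist y Z < t}"
    using closure_closed[OF clN] N by (simp only: frontier_def)
  then show ?thesis by auto
qed

text \<open>
  The library's \<^const>\<open>unit_ball_vol\<close> is the constant \<open>\<kappa>\<^sub>j\<close> of the Steiner formula.
  The coefficients are taken in \<open>[0, \<infinity>]\<close>, so neither their finiteness nor their existence is built
  in.  They are unique when \<^term>\<open>Z\<close> is bounded.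
\<close>

definition steiner_coeffs :: "'a::euclidean_space set \<Rightarrow> (nat \<Rightarrow> ennreal) \<Rightarrow> bool"
  where "steiner_coeffs Z V \<longleftrightarrow>
    (\<forall>t>0. emeasure lborel (closed_nbhd Z t) =
      (\<Sum>k\<le>DIM('a). ennreal (unit_ball_vol (real (DIM('a) - k))) * V k * ennreal (t ^ (DIM('a) - k))))
    \<and> (\<forall>k>DIM('a). V k = 0)"

text \<open>
  For unbounded \<^term>\<open>Z\<close> both sides of the Steiner formula are infinite and it no longer determines
  its coefficients.  There the intrinsic volumes are extended monotonically, as usual, from the
  compact convex subsets.
\<close>

definition intrinsic_volume :: "'a::euclidean_space set \<Rightarrow> nat \<Rightarrow> ennreal"
  where "intrinsic_volume Z k =
    (if bounded Z then (THE V. steiner_coeffs Z V) k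
     else (SUP K \<in> {K. compact K \<and> convex K \<and> K \<noteq> {} \<and> K \<subseteq> Z}. (THE V. steiner_coeffs K V) k))"

text \<open>
  For unbounded \<^term>\<open>Z\<close> the volume of the neighbourhood is infinite; the increment in its
  difference quotient is then read as the volume of the shell between two neighbourhoods.
\<close>

definition level_set_area :: "'a::euclidean_space set \<Rightarrow> real \<Rightarrow> ennreal"
  where "level_set_area Z t =
    (if bounded Z then ennreal (deriv (\<lambda>s. measure lborel (closed_nbhd Z s)) t)
     else Lim (at t) (\<lambda>s. emeasure lborel (closed_nbhd Z (max s t) - closed_nbhd Z (min s t))
                            / ennreal \<bar>s - t\<bar>))"

definition normalizing_const :: "'a::euclidean_space set \<Rightarrow> real \<Rightarrow> ennreal"
  where "normalizing_const Z \<sigma> =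
    (\<integral>\<^sup>+t\<in>{0<..}. ennreal (exp (- t\<^sup>2 / \<sigma>)) * level_set_area Z t \<partial>lborel)"

end

(*
  Steiner's formula.  For a polytope P, split space according to the face F whose relative interior
  contains the nearest point p y.  On the region of F the map y \<mapsto> p y + t (y - p y) is affine, equal
  to the identity along F and to the dilation by t across F, so the part of the t-neighbourhood in
  this region has volume proportional to t^(d - dim F).  Summing over faces gives a polynomial with
  nonnegative coefficients, and a compact convex set is sandwiched between polytopes and their small
  neighbourhoods, so its coefficients arise as limits along a subsequence.

  Positivity.  The bound must survive the limit.  If P contains a k-dimensional disc parallel to E,
  consider y \<mapsto> \<rho> (p y - x0) + (1 - \<rho>) (y - p y), where \<rho> projects onto E.  It maps some neighbourhood
  of P onto a ball of controlled radius.  The regions of faces of dimension other than k have null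
  image, as their image has too small a dimension, so the faces of dimension k must carry a definite
  amount of volume.

  Normalizing constant.  For bounded sets, integrate the derivative of the Steiner polynomial against
  the Gaussian.  For unbounded sets both sides are infinite: segments in Z make V_1 infinite, and the
  level sets are unbounded because the complement of a ball is connected, so that every shell contains
  infinitely many disjoint balls of equal radius.
*)
theory Submission
  imports Defs
begin

subsection \<open>Lebesgue measure under linear maps\<close>

text \<open>
  This is uniqueness of translation-invariant measure: integrate
  \<open>indicator A (f x) * indicator B (y + f x)\<close> in both orders.  The library's determinant formula needs
  a well-ordered index type and does not apply here.
\<close>

lemma emeasure_linear_vimage_ratio:
  fixes f g :: "'a::euclidean_space \<Rightarrow> 'a"
  assumes f: "linear f" and g: "linear g" and fg: "\<And>x. f (g x) = x"
    and [measurable]: "A \<in> sets borel" "B \<in> sets borel"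
  shows "emeasure lborel (f -` A) * emeasure lborel B = emeasure lborel (f -` B) * emeasure lborel A"
proof -
  have fm [measurable]: "f \<in> borel_measurable borel" "g \<in> borel_measurable borel"
    using f g by (auto intro!: borel_measurable_continuous_onI linear_continuous_on
        simp: linear_linear)
  have vim [measurable]: "f -` X \<in> sets borel" if "X \<in> sets borel" for X
    using measurable_sets[OF fm(1) that] by simp
  have trans: "(\<integral>\<^sup>+x. h (x + c) \<partial>lborel) = (\<integral>\<^sup>+x. h x \<partial>lborel)"
    if [measurable]: "h \<in> borel_measurable borel" for h :: "'a \<Rightarrow> ennreal" and c
  proof -
    have "lborel = density (distr lborel borel (\<lambda>x. c + 1 *\<^sub>R x)) (\<lambda>_. ennreal (\<bar>1\<bar>^DIM('a)))"
      by (rule lborel_affine) simp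
    then have "lborel = distr lborel borel (\<lambda>x::'a. x + c)"
      by (simp add: density_1 add.commute)
    then have "(\<integral>\<^sup>+x. h x \<partial>lborel) = (\<integral>\<^sup>+x. h x \<partial>distr lborel borel (\<lambda>x::'a. x + c))"
      by simp
    also have "\<dots> = (\<integral>\<^sup>+x. h (x + c) \<partial>lborel)"
      by (subst nn_integral_distr) auto
    finally show ?thesis by simp
  qed
  have refl: "(\<integral>\<^sup>+x. h (c - x) \<partial>lborel) = (\<integral>\<^sup>+x. h x \<partial>lborel)"
    if [measurable]: "h \<in> borel_measurable borel" for h :: "'a \<Rightarrow> ennreal" and c
  proof -
    have "lborel = density (distr lborel borel (\<lambda>x. c + (-1) *\<^sub>R x)) (\<lambda>_. ennreal (\<bar>-1\<bar>^DIM('a)))"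
      by (rule lborel_affine) simp
    then have "lborel = distr lborel borel (\<lambda>x::'a. c - x)"
      by (simp add: density_1)
    then have "(\<integral>\<^sup>+x. h x \<partial>lborel) = (\<integral>\<^sup>+x. h x \<partial>distr lborel borel (\<lambda>x::'a. c - x))"
      by simp
    also have "\<dots> = (\<integral>\<^sup>+x. h (c - x) \<partial>lborel)"
      by (subst nn_integral_distr) auto
    finally show ?thesis by simp
  qed
  let ?I = "\<lambda>S x. indicator S x :: ennreal"
  have "emeasure lborel (f -` A) * emeasure lborel B
      = (\<integral>\<^sup>+x. ?I A (f x) * emeasure lborel B \<partial>lborel)"
    by (subst nn_integral_multc) (simp_all add: indicator_vimage[symmetric])
  also have "\<dots> = (\<integral>\<^sup>+x. \<integral>\<^sup>+y. ?I A (f x) * ?I B (y + f x) \<partial>lborel \<partial>lborel)"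
    by (subst nn_integral_cmult) (auto simp: trans)
  also have "\<dots> = (\<integral>\<^sup>+y. \<integral>\<^sup>+x. ?I A (f x) * ?I B (y + f x) \<partial>lborel \<partial>lborel)"
    by (rule lborel_pair.Fubini') measurable
  also have "\<dots> = (\<integral>\<^sup>+y. \<integral>\<^sup>+x. ?I A (f x - y) * ?I B (f x) \<partial>lborel \<partial>lborel)"
  proof (rule nn_integral_cong)
    fix y
    show "(\<integral>\<^sup>+x. ?I A (f x) * ?I B (y + f x) \<partial>lborel) = (\<integral>\<^sup>+x. ?I A (f x - y) * ?I B (f x) \<partial>lborel)"
      \<comment> \<open>Shifting \<open>x\<close> by \<open>g y\<close> turns \<open>f x\<close>
        into \<open>f x + y\<close>, since \<open>f (g y) = y\<close>.\<close>
      using trans[of "\<lambda>x. ?I A (f x - y) * ?I B (f x)" "g y"]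
      by (simp add: linear_add[OF f] fg add.commute)
  qed
  also have "\<dots> = (\<integral>\<^sup>+x. \<integral>\<^sup>+y. ?I A (f x - y) * ?I B (f x) \<partial>lborel \<partial>lborel)"
    by (rule lborel_pair.Fubini') measurable
  also have "\<dots> = (\<integral>\<^sup>+x. ?I B (f x) * emeasure lborel A \<partial>lborel)"
    by (subst nn_integral_multc) (auto simp: refl mult.commute)
  also have "\<dots> = emeasure lborel (f -` B) * emeasure lborel A"
    by (subst nn_integral_multc) (simp_all add: indicator_vimage[symmetric])
  finally show ?thesis .
qed

lemma emeasure_unit_ball_pos_finite:
  "emeasure lborel (ball (0::'a::euclidean_space) 1) \<noteq> 0"
  "emeasure lborel (ball (0::'a::euclidean_space) 1) \<noteq> \<infinity>"
  using less_imp_neq[OF unit_ball_vol_pos[of "real DIM('a)"]] by (simp_all add: emeasure_ball)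

text \<open>The unit ball is its own preimage, so comparison with it shows that the scaling ratio is
  1.\<close>

lemma emeasure_orthogonal_vimage:
  fixes f :: "'a::euclidean_space \<Rightarrow> 'a"
  assumes f: "orthogonal_transformation f" and A: "A \<in> sets borel"
  shows "emeasure lborel (f -` A) = emeasure lborel A"
proof -
  obtain g where g: "linear g" "\<And>x. f (g x) = x"
    using linear_injective_isomorphism[OF orthogonal_transformation_linear[OF f] orthogonal_transformation_inj[OF f]]
    by metis
  have "f -` ball 0 1 = ball 0 1"
    using orthogonal_transformation_norm[OF f] by auto
  then show ?thesis
    using emeasure_linear_vimage_ratio[OF orthogonal_transformation_linear[OF f] g A, of "ball 0 1"]
      emeasure_unit_ball_pos_finite[where 'a='a]
    by (simp add: mult.commute[of _ "emeasure lborel (ball 0 1)"] ennreal_mult_cancel_left)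
qed

section \<open>Orthogonal projections and dilations across a subspace\<close>

definition orth_proj :: "'a::euclidean_space set \<Rightarrow> ('a \<Rightarrow> 'a) \<Rightarrow> bool"
  where "orth_proj S \<pi> \<longleftrightarrow> subspace S \<and> linear \<pi> \<and> (\<forall>x. \<pi> x \<in> S) \<and> (\<forall>x. \<forall>s\<in>S. (x - \<pi> x) \<bullet> s = 0)"

lemma orth_projD:
  assumes "orth_proj S \<pi>"
  shows "subspace S" "linear \<pi>" "\<pi> x \<in> S" "s \<in> S \<Longrightarrow> (x - \<pi> x) \<bullet> s = 0"
  using assms by (auto simp: orth_proj_def)

text \<open>The difference \<open>\<pi> x - y\<close> lies in \<open>S\<close> and is orthogonal to
  \<open>S\<close>, hence to itself.\<close>

lemma orth_proj_eqI:
  assumes \<pi>: "orth_proj S \<pi>" and y: "y \<in> S" "\<And>s. s \<in> S \<Longrightarrow> (x - y) \<bullet> s = 0"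
  shows "\<pi> x = y"
proof -
  have "\<pi> x - y \<in> S"
    using orth_projD[OF \<pi>] y subspace_diff by blast
  then have "(x - y) \<bullet> (\<pi> x - y) - (x - \<pi> x) \<bullet> (\<pi> x - y) = 0"
    using orth_projD(4)[OF \<pi>] y by simp
  then have "(\<pi> x - y) \<bullet> (\<pi> x - y) = 0"
    by (simp add: inner_diff_left)
  then show ?thesis by simp
qed

lemma orth_proj_simps:
  assumes \<pi>: "orth_proj S \<pi>"
  shows "s \<in> S \<Longrightarrow> \<pi> s = s" "\<pi> (\<pi> x) = \<pi> x" "\<pi> (x - \<pi> x) = 0"
    "\<pi> (x + y) = \<pi> x + \<pi> y" "\<pi> (x - y) = \<pi> x - \<pi> y" "\<pi> (c *\<^sub>R x) = c *\<^sub>R \<pi> x" "\<pi> 0 = 0"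
proof -
  note l = linear_add linear_diff linear_cmul linear_0
  show *: "s \<in> S \<Longrightarrow> \<pi> s = s" for s using orth_proj_eqI[OF \<pi>, of s s] by simp
  show "\<pi> (\<pi> x) = \<pi> x" using *[OF orth_projD(3)[OF \<pi>]] .
  then show "\<pi> (x - \<pi> x) = 0" by (simp add: l(2)[OF orth_projD(2)[OF \<pi>]])
qed (simp_all add: linear_add linear_diff linear_cmul linear_0 orth_projD(2)[OF \<pi>])

lemma orth_proj_inner:
  assumes \<pi>: "orth_proj S \<pi>"
  shows "\<pi> x \<bullet> y = \<pi> x \<bullet> \<pi> y" "x \<bullet> \<pi> y = \<pi> x \<bullet> \<pi> y"
  using orth_projD(4)[OF \<pi> orth_projD(3)[OF \<pi>], of x y] orth_projD(4)[OF \<pi> orth_projD(3)[OF \<pi>], of y x]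
  by (simp_all add: inner_diff_left inner_diff_right inner_commute)

lemma orth_proj_norm:
  assumes \<pi>: "orth_proj S \<pi>"
  shows "norm (\<pi> x) \<le> norm x" "norm (x - \<pi> x) \<le> norm x"
proof -
  have "(norm x)\<^sup>2 = (norm (\<pi> x))\<^sup>2 + (norm (x - \<pi> x))\<^sup>2"
    using orth_proj_inner[OF \<pi>, of x x]
    by (simp add: power2_norm_eq_inner inner_diff_left inner_diff_right inner_commute)
  then have "(norm (\<pi> x))\<^sup>2 \<le> (norm x)\<^sup>2" "(norm (x - \<pi> x))\<^sup>2 \<le> (norm x)\<^sup>2"
    by simp_all
  then show "norm (\<pi> x) \<le> norm x" "norm (x - \<pi> x) \<le> norm x"
    by (auto intro: power2_le_imp_le)
qed

lemma orth_proj_exists: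
  fixes S :: "'a::euclidean_space set"
  assumes "subspace S"
  obtains \<pi> where "orth_proj S \<pi>"
proof -
  obtain B where B: "B \<subseteq> S" "pairwise orthogonal B" "\<And>x. x \<in> B \<Longrightarrow> norm x = 1"
     "independent B" "span B = S"
    using orthonormal_basis_subspace[OF assms] by metis
  have fin: "finite B" using B independent_imp_finite by blast
  define \<pi> where "\<pi> x = (\<Sum>b\<in>B. (x \<bullet> b) *\<^sub>R b)" for x :: 'a
  have "linear \<pi>"
    unfolding \<pi>_def by (intro linearI)
      (simp_all add: inner_add_left scaleR_add_left sum.distrib scaleR_right.sum)
  moreover have "\<pi> x \<in> S" for x
    unfolding \<pi>_def using assms B by (intro subspace_sum subspace_scale) auto
  moreover have "(x - \<pi> x) \<bullet> s = 0" if "s \<in> S" for x s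
  proof -
    have *: "(x - \<pi> x) \<bullet> c = 0" if "c \<in> B" for c
    proof -
      have "\<pi> x \<bullet> c = (\<Sum>b\<in>B. (x \<bullet> b) * (b \<bullet> c))"
        by (simp add: \<pi>_def inner_sum_left)
      also have "\<dots> = (\<Sum>b\<in>B. if b = c then x \<bullet> b else 0)"
        using B that by (intro sum.cong)
          (auto simp: pairwise_def orthogonal_def power2_norm_eq_inner[symmetric])
      also have "\<dots> = x \<bullet> c" using that fin by simp
      finally show ?thesis by (simp add: inner_diff_left)
    qed
    have "s \<in> span B" using that B by simp
    then have "orthogonal (x - \<pi> x) s"
      by (rule orthogonal_to_span) (use * in \<open>simp add: orthogonal_def\<close>)
    then show ?thesis by (simp add: orthogonal_def)
  qed
  ultimately show ?thesis using that[of \<pi>] assms by (simp add: orth_proj_def)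
qed

text \<open>Orthonormal bases of \<open>S\<close> and of its orthogonal complement are matched
  together with the standard basis. In the new coordinates \<open>\<pi>\<close> is a coordinate
  projection, so a dilation across \<open>S\<close> becomes diagonal.\<close>

lemma orthogonal_adapted_to_subspace:
  fixes S :: "'a::euclidean_space set"
  assumes \<pi>: "orth_proj S \<pi>"
  obtains f :: "'a \<Rightarrow> 'a" and B where "orthogonal_transformation f" "B \<subseteq> Basis" "card B = dim S"
    "\<And>i. i \<in> B \<Longrightarrow> \<pi> (f i) = f i" "\<And>i. i \<in> Basis - B \<Longrightarrow> \<pi> (f i) = 0"
proof -
  note S = orth_projD(1)[OF \<pi>]
  define S' where "S' = {y \<in> UNIV. \<forall>x \<in> S. orthogonal x y}"
  have S': "subspace S'" unfolding S'_def by (simp add: subspace_orthogonal_to_vectors)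
  have dimS': "dim S' + dim S = DIM('a)"
    using dim_subspace_orthogonal_to_vectors[OF S subspace_UNIV subset_UNIV] by (simp add: S'_def)
  obtain C where C: "C \<subseteq> S" "pairwise orthogonal C" "\<And>x. x \<in> C \<Longrightarrow> norm x = 1"
     "independent C" "card C = dim S"
    using orthonormal_basis_subspace[OF S] by metis
  obtain C' where C': "C' \<subseteq> S'" "pairwise orthogonal C'" "\<And>x. x \<in> C' \<Longrightarrow> norm x = 1"
     "independent C'" "card C' = dim S'"
    using orthonormal_basis_subspace[OF S'] by metis
  have CC': "orthogonal x y" if "x \<in> C" "y \<in> C'" for x y
    using that C(1) C'(1) by (auto simp: S'_def)
  have disj: "C \<inter> C' = {}"
  proof (rule ccontr)
    assume "C \<inter> C' \<noteq> {}"
    then obtain x where "x \<in> C" "x \<in> C'" by auto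
    then show False using CC'[of x x] C(3)[of x] by (simp add: orthogonal_def)
  qed
  have fin: "finite C" "finite C'" using C(4) C'(4) by (auto intro: independent_imp_finite)
  have "dim S \<le> card (Basis :: 'a set)" using dimS' by simp
  then obtain B where B: "B \<subseteq> (Basis :: 'a set)" "card B = dim S" "finite B"
    by (rule obtain_subset_with_card_n)
  obtain h1 where h1: "bij_betw h1 B C"
    using finite_same_card_bij[OF B(3) fin(1)] B C by auto
  have "card (Basis - B) = card C'"
    using B C'(5) dimS' by (simp add: card_Diff_subset)
  then obtain h2 where h2: "bij_betw h2 (Basis - B) C'"
    using finite_same_card_bij[of "Basis - B" C'] fin by auto
  define h where "h i = (if i \<in> B then h1 i else h2 i)" for i
  have hB: "h i \<in> C" if "i \<in> B" for i
    using that h1 by (auto simp: h_def bij_betw_def)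
  have hB': "h i \<in> C'" if "i \<in> Basis - B" for i
    using that h2 by (auto simp: h_def bij_betw_def)
  have hh: "h i \<bullet> h j = (if i = j then 1 else 0)" if "i \<in> Basis" "j \<in> Basis" for i j
  proof (cases "i = j")
    case True
    then show ?thesis using that hB[of i] hB'[of i] C(3) C'(3)
      by (cases "i \<in> B") (auto simp: power2_norm_eq_inner[symmetric])
  next
    case False
    have "orthogonal (h i) (h j)"
    proof (cases "i \<in> B"; cases "j \<in> B")
      assume ij: "i \<in> B" "j \<in> B"
      then have "h i \<noteq> h j" using False h1 by (auto simp: h_def bij_betw_def inj_on_def)
      then show ?thesis using C(2) hB ij by (auto simp: pairwise_def)
    next
      assume ij: "i \<notin> B" "j \<notin> B"
      then have "h i \<noteq> h j" using False h2 that by (auto simp: h_def bij_betw_def inj_on_def)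
      then show ?thesis using C'(2) hB' ij that by (auto simp: pairwise_def)
    next
      assume "i \<in> B" "j \<notin> B"
      then show ?thesis using CC' hB hB' that by auto
    next
      assume "i \<notin> B" "j \<in> B"
      then show ?thesis using CC' hB hB' that orthogonal_commute by blast
    qed
    then show ?thesis using False by (simp add: orthogonal_def)
  qed
  define f where "f x = (\<Sum>i\<in>Basis. (x \<bullet> i) *\<^sub>R h i)" for x :: 'a
  have lin: "linear f"
    unfolding f_def by (intro linearI)
      (simp_all add: inner_add_left scaleR_add_left sum.distrib scaleR_right.sum)
  have fi: "f i = h i" if "i \<in> Basis" for i
  proof -
    have "f i = (\<Sum>j\<in>Basis. if j = i then h j else 0)"
      unfolding f_def using that by (intro sum.cong) (auto simp: inner_Basis)
    then show ?thesis using that by simp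
  qed
  have "f v \<bullet> f w = v \<bullet> w" for v w
  proof -
    have "f v \<bullet> f w = (\<Sum>j\<in>Basis. \<Sum>i\<in>Basis. (v \<bullet> i) * (w \<bullet> j) * (h i \<bullet> h j))"
      by (simp add: f_def inner_sum_left inner_sum_right sum_distrib_left mult_ac)
    also have "\<dots> = (\<Sum>j\<in>Basis. \<Sum>i\<in>Basis. if i = j then (v \<bullet> i) * (w \<bullet> j) else 0)"
      by (intro sum.cong) (auto simp: hh)
    also have "\<dots> = v \<bullet> w" by (simp add: euclidean_inner[of v w])
    finally show ?thesis .
  qed
  then have "orthogonal_transformation f" using lin by (simp add: orthogonal_transformation_def)
  moreover have "\<pi> (f i) = f i" if "i \<in> B" for i
  proof -
    have "f i = h i" using fi that B(1) by blast
    then show ?thesis using orth_proj_simps(1)[OF \<pi>, of "h i"] hB[OF that] C(1) by auto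
  qed
  moreover have "\<pi> (f i) = 0" if "i \<in> Basis - B" for i
  proof (rule orth_proj_eqI[OF \<pi> subspace_0[OF S]])
    fix s assume "s \<in> S"
    then show "(f i - 0) \<bullet> s = 0"
      using hB'[OF that] C'(1) fi that by (auto simp: S'_def orthogonal_def inner_commute)
  qed
  ultimately show ?thesis using that B by blast
qed

text \<open>Conjugation by the adapted orthogonal map \<open>f\<close> turns the dilation into the
  diagonal map \<open>D\<close>, with entry 1 on \<open>B\<close> and \<open>c\<close> on the
  remaining axes. Only the latter contribute to the volume factor.\<close>

lemma emeasure_orth_scaling:
  fixes S :: "'a::euclidean_space set"
  assumes \<pi>: "orth_proj S \<pi>" and c: "c > 0" and A: "A \<in> sets borel"
  shows "emeasure lborel ((\<lambda>x. \<pi> x + c *\<^sub>R (x - \<pi> x)) ` A) = ennreal (c ^ (DIM('a) - dim S)) * emeasure lborel A"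
    and "(\<lambda>x. \<pi> x + c *\<^sub>R (x - \<pi> x)) ` A \<in> sets borel"
proof -
  let ?M = "\<lambda>c x. \<pi> x + c *\<^sub>R (x - \<pi> x)"
  obtain f :: "'a \<Rightarrow> 'a" and B where f: "orthogonal_transformation f" and B: "B \<subseteq> Basis" "card B = dim S"
    and fB: "\<And>i. i \<in> B \<Longrightarrow> \<pi> (f i) = f i" and fB': "\<And>i. i \<in> Basis - B \<Longrightarrow> \<pi> (f i) = 0"
    by (rule orthogonal_adapted_to_subspace[OF \<pi>]) blast
  have linf: "linear f" using f by (rule orthogonal_transformation_linear)
  have fm [measurable]: "f \<in> borel_measurable borel"
    using linf by (auto intro!: borel_measurable_continuous_onI linear_continuous_on simp: linear_linear)
  define e where "e i = (if i \<in> B then 1 else c)" for i :: 'a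
  define D where "D x = 0 + (\<Sum>j\<in>Basis. (e j * (x \<bullet> j)) *\<^sub>R j)" for x :: 'a
  have e0: "e j \<noteq> 0" for j using c by (auto simp: e_def)
  have Dm [measurable]: "D \<in> borel_measurable borel"
    unfolding D_def by simp
  have linM: "linear (?M c)"
    using orth_projD(2)[OF \<pi>] by (intro linear_compose_add linear_compose_scale_right linear_compose_sub linear_id[unfolded id_def])
  have pM: "\<pi> (?M b x) = \<pi> x" for b x
    by (simp only: orth_proj_simps(2,3,4,6)[OF \<pi>] scaleR_zero_right add_0_right)
  \<comment> \<open>The dilations compose multiplicatively because \<open>\<pi>\<close> does not see
    the part being stretched. Thus \<open>?M (1/c)\<close> inverts \<open>?M c\<close>, and images
    become preimages of a measurable map.\<close>
  have Minv: "?M a (?M b x) = ?M (a * b) x" for a b x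
    unfolding pM by simp
  have Mi: "?M c (?M (1/c) x) = x" "?M (1/c) (?M c x) = x" for x
    using Minv[where a=c and b="1/c" and x=x] Minv[where a="1/c" and b=c and x=x] c by simp_all
  have Mm [measurable]: "?M b \<in> borel_measurable borel" for b
  proof -
    have "linear (?M b)"
      using orth_projD(2)[OF \<pi>] by (intro linear_compose_add linear_compose_scale_right linear_compose_sub linear_id[unfolded id_def])
    then show ?thesis
      by (auto intro!: borel_measurable_continuous_onI linear_continuous_on simp: linear_linear)
  qed
  have fD: "f (D x) = ?M c (f x)" for x
  proof -
    have "f x = (\<Sum>j\<in>Basis. (x \<bullet> j) *\<^sub>R f j)"
      using linear_sum[OF linf, of "\<lambda>j. (x \<bullet> j) *\<^sub>R j" Basis]
      by (simp add: euclidean_representation linear_cmul[OF linf])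
    then have "?M c (f x) = (\<Sum>j\<in>Basis. (x \<bullet> j) *\<^sub>R ?M c (f j))"
      using linear_sum[OF linM, of "\<lambda>j. (x \<bullet> j) *\<^sub>R f j" Basis] linear_cmul[OF linM] by simp
    also have "\<dots> = (\<Sum>j\<in>Basis. (e j * (x \<bullet> j)) *\<^sub>R f j)"
      by (intro sum.cong) (auto simp: e_def fB fB')
    also have "\<dots> = f (D x)"
      by (simp add: D_def linear_sum[OF linf] linear_cmul[OF linf])
    finally show ?thesis by simp
  qed
  have MA: "?M c ` A = ?M (1/c) -` A"
  proof (intro equalityI subsetI)
    fix y assume "y \<in> ?M (1/c) -` A"
    then have "?M (1/c) y \<in> A" by simp
    then have "?M c (?M (1/c) y) \<in> ?M c ` A" by (rule imageI)
    then show "y \<in> ?M c ` A" by (simp only: Mi(1))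
  next
    fix y assume "y \<in> ?M c ` A"
    then obtain x where "x \<in> A" "y = ?M c x" by blast
    then show "y \<in> ?M (1/c) -` A" by (simp only: Mi(2) vimage_eq)
  qed
  show MAb: "?M c ` A \<in> sets borel"
    unfolding MA using measurable_sets[OF Mm[of "1/c"] A] by simp
  let ?Y = "f -` A"
  have Y: "?Y \<in> sets borel" using measurable_sets[OF fm A] by simp
  have eq: "D -` (f -` (?M c ` A)) = ?Y"
  proof -
    have "D -` (f -` (?M c ` A)) = {x. ?M c (f x) \<in> ?M (1/c) -` A}"
      unfolding MA by (simp only: vimage_def fD mem_Collect_eq)
    also have "\<dots> = ?Y"
      by (simp only: vimage_def Mi(2) mem_Collect_eq)
    finally show ?thesis .
  qed
  have fMA: "f -` (?M c ` A) \<in> sets borel" using measurable_sets[OF fm MAb] by simp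
  have "emeasure lborel (?M c ` A) = emeasure lborel (f -` (?M c ` A))"
    using emeasure_orthogonal_vimage[OF f MAb] by simp
  also have "\<dots> = emeasure (density (distr lborel borel D) (\<lambda>_. (\<Prod>j\<in>Basis. \<bar>e j\<bar>))) (f -` (?M c ` A))"
    unfolding D_def
    by (rule arg_cong[where f = "\<lambda>M. emeasure M _", OF lborel_affine_euclidean]) (rule e0)
  also have "\<dots> = ennreal (\<Prod>j\<in>Basis. \<bar>e j\<bar>) * emeasure lborel ?Y"
    using fMA by (simp add: emeasure_density nn_integral_cmult emeasure_distr eq)
  also have "(\<Prod>j\<in>Basis. \<bar>e j\<bar>) = (\<Prod>j\<in>Basis - B. c)"
    using B c by (intro prod.mono_neutral_cong_right) (auto simp: e_def)
  also have "\<dots> = c ^ (DIM('a) - dim S)"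
    using B finite_subset[OF B(1)] by (simp add: card_Diff_subset)
  also have "emeasure lborel ?Y = emeasure lborel A"
    using emeasure_orthogonal_vimage[OF f A] .
  finally show "emeasure lborel (?M c ` A) = ennreal (c ^ (DIM('a) - dim S)) * emeasure lborel A" .
qed

text \<open>A singular map has a null image. For an invertible one the volume ratio is the same for
  all sets, and it can be read off the unit ball, whose image lies in the ball of radius
  \<open>L\<close>.\<close>

lemma linear_image_measure_le:
  fixes G :: "'a::euclidean_space \<Rightarrow> 'a"
  assumes G: "linear G" and L: "\<And>x. norm (G x) \<le> L * norm x" "L > 0"
    and S: "S \<in> sets borel" "bounded S"
  shows "G ` S \<in> lmeasurable \<and> measure lebesgue (G ` S) \<le> L ^ DIM('a) * measure lebesgue S"
proof (cases "inj G")
  case False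
  have "dim (range G) < DIM('a)"
    by (metis False G dim_eq_full dim_subset_UNIV le_neq_implies_less linear_injective_imp_surjective
        linear_surjective_imp_injective span_eq_iff linear_subspace_image subspace_UNIV)
  then have "negligible (G ` S)"
    using negligible_lowdim negligible_subset by (metis image_mono subset_UNIV)
  then show ?thesis using L
    by (simp add: negligible_imp_measurable negligible_imp_measure0)
next
  case True
  obtain g where g: "linear g" "\<And>x. g (G x) = x" "\<And>x. G (g x) = x"
    using linear_injective_isomorphism[OF G True] by metis
  have im: "G ` X = g -` X" for X using g by (auto simp: image_iff) metis
  have gm: "g \<in> borel_measurable borel"
    using g by (auto intro!: borel_measurable_continuous_onI linear_continuous_on simp: linear_linear)
  have Gb: "G ` X \<in> sets borel" if "X \<in> sets borel" for X
    unfolding im using measurable_sets[OF gm that] by simp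
  have bd: "bounded (G ` X)" if "bounded X" for X
    using bounded_linear_image[OF that] G by (simp add: linear_linear)
  have fin: "X \<in> fmeasurable lborel" if "X \<in> sets borel" "bounded X" for X :: "'a set"
    using that emeasure_bounded_finite[of X] by (auto simp: fmeasurable_def)
  let ?b = "ball (0::'a) 1"
  let ?m = "measure lborel :: 'a set \<Rightarrow> real"
  have "G ` ?b \<subseteq> ball 0 L"
  proof
    fix y assume "y \<in> G ` ?b"
    then obtain x where x: "y = G x" "norm x < 1" by auto
    have "norm y \<le> L * norm x" using L x by simp
    also have "\<dots> < L" using x L by simp
    finally show "y \<in> ball 0 L" by simp
  qed
  then have "?m (G ` ?b) \<le> ?m (ball 0 L)"
    using Gb by (intro measure_mono_fmeasurable fin) auto
  also have "\<dots> = L ^ DIM('a) * ?m ?b"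
    using L by (simp add: content_ball)
  finally have le: "?m (G ` ?b) \<le> L ^ DIM('a) * ?m ?b" .
  have "emeasure lborel (G ` S) * emeasure lborel ?b = emeasure lborel (G ` ?b) * emeasure lborel S"
    unfolding im using emeasure_linear_vimage_ratio[OF g(1) G g(2), of S ?b] S by simp
  then have "enn2real (emeasure lborel (G ` S) * emeasure lborel ?b)
     = enn2real (emeasure lborel (G ` ?b) * emeasure lborel S)" by simp
  then have "?m (G ` S) * ?m ?b = ?m (G ` ?b) * ?m S"
    by (simp add: measure_def enn2real_mult)
  also have "\<dots> \<le> L ^ DIM('a) * ?m ?b * ?m S"
    using le by (intro mult_right_mono) auto
  finally have "?m (G ` S) * ?m ?b \<le> (L ^ DIM('a) * ?m S) * ?m ?b" by (simp add: mult_ac)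
  moreover have "?m ?b > 0" by (simp add: content_ball)
  ultimately have "?m (G ` S) \<le> L ^ DIM('a) * ?m S" by (simp only: mult_le_cancel_right_pos)
  moreover have "G ` S \<in> sets borel" "S \<in> sets borel" using Gb S by auto
  ultimately show ?thesis
    using fin[OF Gb[OF S(1)] bd[OF S(2)]] by (auto simp: fmeasurable_def measure_completion)
qed

subsection \<open>Steiner polynomial of a polytope\<close>

text \<open>The smallest face containing \<open>x\<close> works: on its relative frontier,
  \<open>x\<close> would lie in a proper face of it, which is again a face of
  \<open>P\<close>.\<close>

lemma polytope_face_rel_interior:
  fixes P :: "'a::euclidean_space set"
  assumes "polytope P" "x \<in> P"
  obtains F where "F face_of P" "x \<in> rel_interior F"
proof -
  define C where "C = \<Inter>{F. F face_of P \<and> x \<in> F}"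
  have C: "C face_of P"
    unfolding C_def using assms polytope_imp_convex by (intro face_of_Inter) (auto intro: face_of_refl)
  have xC: "x \<in> C" by (auto simp: C_def)
  have polyC: "polytope C" using C assms(1) face_of_polytope_polytope by blast
  have "x \<in> rel_interior C"
  proof (rule ccontr)
    assume "x \<notin> rel_interior C"
    then have "x \<in> rel_frontier C"
      using xC closure_subset by (auto simp: rel_frontier_def)
    then obtain F where F: "F face_of C" "F \<noteq> C" "x \<in> F"
      using rel_frontier_of_polyhedron_alt[OF polytope_imp_polyhedron[OF polyC]] by auto
    then have "C \<subseteq> F" using face_of_trans[OF F(1) C] by (auto simp: C_def)
    then show False using F face_of_imp_subset by blast
  qed
  then show ?thesis using that C by blast
qed

section \<open>Nearest points and the regions of the faces\<close>

lemma closest_point_eqI: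
  fixes S :: "'a::euclidean_space set"
  assumes "convex S" "closed S" "x \<in> S" "\<And>z. z \<in> S \<Longrightarrow> (a - x) \<bullet> (z - x) \<le> 0"
  shows "closest_point S a = x"
proof (rule closest_point_unique[symmetric, OF assms(1-3)], intro ballI)
  fix z assume "z \<in> S"
  have "(dist a z)\<^sup>2 = (dist a x)\<^sup>2 - 2 * ((a - x) \<bullet> (z - x)) + (dist z x)\<^sup>2"
    by (simp add: dist_norm power2_norm_eq_inner algebra_simps inner_commute)
  then have "(dist a x)\<^sup>2 \<le> (dist a z)\<^sup>2" using assms(4)[OF \<open>z \<in> S\<close>] zero_le_power2[of "dist z x"] by linarith
  then show "dist a x \<le> dist a z" by (rule power2_le_imp_le) simp
qed

text \<open>The obtuse-angle condition at the nearest point is homogeneous in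
  \<open>y - closest_point S y\<close>, so it persists along the whole ray.\<close>

lemma closest_point_ray:
  fixes S :: "'a::euclidean_space set"
  assumes "convex S" "closed S" "S \<noteq> {}" "c \<ge> 0"
  shows "closest_point S (closest_point S y + c *\<^sub>R (y - closest_point S y)) = closest_point S y"
  using assms closest_point_dot[OF assms(1,2), of _ y]
  by (intro closest_point_eqI) (auto simp: closest_point_in_set mult_nonneg_nonpos)

lemma infdist_closest_point:
  fixes S :: "'a::euclidean_space set"
  assumes "closed S" "S \<noteq> {}"
  shows "infdist y S = dist y (closest_point S y)"
proof -
  obtain z where "z \<in> S" "infdist y S = dist y z"
    using infdist_attains_inf[OF assms] by blast
  then show ?thesis
    using closest_point_le[OF assms(1), of z y] infdist_le[OF closest_point_in_set[OF assms], of y y]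
    by simp
qed

lemma mem_closed_nbhd:
  fixes S :: "'a::euclidean_space set"
  assumes "closed S" "S \<noteq> {}"
  shows "y \<in> closed_nbhd S t \<longleftrightarrow> norm (y - closest_point S y) \<le> t"
  using closed_nbhd_eq_infdist[OF assms, of t] infdist_closest_point[OF assms, of y]
  by (simp add: dist_norm)

lemma compact_closed_nbhd:
  fixes S :: "'a::euclidean_space set"
  assumes "compact S"
  shows "compact (closed_nbhd S t)"
proof -
  have "closed_nbhd S t = {x + y | x y. x \<in> S \<and> y \<in> cball 0 t}"
    by (auto simp: closed_nbhd_def)
  then show ?thesis using compact_sums[OF assms compact_cball[of 0 t]] by (simp only:)
qed

text \<open>For a polytope this is the sum of the relative interior of \<open>F\<close> and the
  normal cone of \<open>P\<close> along \<open>F\<close>, truncated at radius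
  \<open>t\<close>.\<close>

definition face_region :: "'a::euclidean_space set \<Rightarrow> 'a set \<Rightarrow> real \<Rightarrow> 'a set"
  where "face_region P F t = {y. closest_point P y \<in> rel_interior F \<and> norm (y - closest_point P y) \<le> t}"

lemma face_region_borel:
  fixes P :: "'a::euclidean_space set"
  assumes P: "polytope P" "P \<noteq> {}" and F: "F face_of P"
  shows "face_region P F t \<in> sets borel" "bounded (face_region P F t)"
proof -
  have cP: "convex P" "closed P" "compact P"
    using P by (auto simp: polytope_imp_convex polytope_imp_closed polytope_imp_compact)
  have cF: "closed F" using F P face_of_imp_closed cP by blast
  \<comment> \<open>A difference of two closed sets, hence Borel.\<close>
  have "rel_interior F = F - rel_frontier F"
    using cF rel_interior_subset[of F] by (auto simp: rel_frontier_def)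
  then have [measurable]: "rel_interior F \<in> sets borel"
    using cF closed_rel_frontier[of F] by auto
  have [measurable]: "closest_point P \<in> borel_measurable borel"
    using continuous_on_closest_point[OF cP(1,2) P(2)] by (rule borel_measurable_continuous_onI)
  show "face_region P F t \<in> sets borel" unfolding face_region_def by measurable
  have "face_region P F t \<subseteq> closed_nbhd P t"
    using mem_closed_nbhd[OF cP(2) P(2)] by (auto simp: face_region_def)
  then show "bounded (face_region P F t)"
    using compact_closed_nbhd[OF cP(3)] compact_imp_bounded bounded_subset by blast
qed

text \<open>When the nearest point is relatively interior to \<open>F\<close>, the residual
  \<open>y - closest_point P y\<close> is orthogonal to all directions of \<open>F\<close>. The
  nearest-point map therefore agrees on this region with the orthogonal projection onto the affine
  hull of \<open>F\<close>.\<close>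

lemma closest_point_face_region:
  fixes P :: "'a::euclidean_space set"
  assumes P: "convex P" "closed P" and F: "F face_of P" "a \<in> F"
    and \<pi>: "orth_proj (span ((+) (- a) ` F)) \<pi>" and y: "closest_point P y \<in> rel_interior F"
  shows "closest_point P y = a + \<pi> (y - a)"
proof -
  let ?p = "closest_point P y"
  have FP: "F \<subseteq> P" "convex F" using F face_of_imp_subset face_of_imp_convex by auto
  have pF: "?p \<in> F" using y rel_interior_subset by blast
  have orth: "(y - ?p) \<bullet> (x - ?p) = 0" if x: "x \<in> F" for x
  proof (rule antisym)
    show "(y - ?p) \<bullet> (x - ?p) \<le> 0" using closest_point_dot[OF P] FP x by blast
    \<comment> \<open>The segment from \<open>x\<close> to \<open>?p\<close> can be prolonged beyond
      \<open>?p\<close> inside \<open>F\<close>; the angle condition at the prolonged point has the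
      opposite sign.\<close>
    obtain e where e: "e > 1" "(1 - e) *\<^sub>R x + e *\<^sub>R ?p \<in> F"
      using convex_rel_interior_if2[OF FP(2) y] hull_inc[OF x] by blast
    have "(y - ?p) \<bullet> ((1 - e) *\<^sub>R x + e *\<^sub>R ?p - ?p) \<le> 0"
      using closest_point_dot[OF P] FP e(2) by blast
    also have "(1 - e) *\<^sub>R x + e *\<^sub>R ?p - ?p = - (e - 1) *\<^sub>R (x - ?p)"
      by (simp add: algebra_simps)
    finally show "0 \<le> (y - ?p) \<bullet> (x - ?p)" using e(1)
      by (simp add: mult_le_0_iff)
  qed
  have "\<pi> (y - a) = ?p - a"
  proof (rule orth_proj_eqI[OF \<pi>])
    show "?p - a \<in> span ((+) (- a) ` F)"
      using pF by (intro span_base) (auto intro!: image_eqI[of _ _ ?p])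
    fix s assume s: "s \<in> span ((+) (- a) ` F)"
    have "orthogonal (y - ?p) s"
    proof (rule orthogonal_to_span[OF s])
      fix u assume "u \<in> (+) (- a) ` F"
      then obtain x where x: "x \<in> F" "u = (x - ?p) - (a - ?p)" by auto
      have "(y - ?p) \<bullet> u = 0"
        unfolding x(2) inner_diff_right[of _ "x - ?p"] using orth[OF x(1)] orth[OF F(2)] by simp
      then show "orthogonal (y - ?p) u" by (simp add: orthogonal_def)
    qed
    then show "(y - a - (?p - a)) \<bullet> s = 0" by (simp add: orthogonal_def)
  qed
  then show ?thesis by simp
qed

lemma measure_orth_scaling:
  fixes S :: "'a::euclidean_space set"
  assumes \<pi>: "orth_proj S \<pi>" and c: "c > 0" and A: "A \<in> sets borel"
  shows "measure lebesgue ((\<lambda>x. \<pi> x + c *\<^sub>R (x - \<pi> x)) ` A) = c ^ (DIM('a) - dim S) * measure lebesgue A"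
  using emeasure_orth_scaling[OF assms] A c
  by (simp add: measure_completion measure_def enn2real_mult)

lemma borel_translation:
  fixes A :: "'a::euclidean_space set"
  assumes "A \<in> sets borel"
  shows "(+) a ` A \<in> sets borel"
proof -
  have "(+) a ` A = (\<lambda>x. x - a) -` A" by (auto simp: image_iff algebra_simps) (metis add_diff_cancel_left' diff_add_cancel add.commute)
  moreover have "(\<lambda>x::'a. x - a) \<in> borel_measurable borel" by measurable
  ultimately show ?thesis using measurable_sets[OF _ assms, of "\<lambda>x. x - a" borel] by simp
qed

text \<open>With origin at a point \<open>a\<close> of \<open>F\<close>, the dilation by
  \<open>t\<close> across the direction space of \<open>F\<close> fixes nearest points and stretches
  residuals by \<open>t\<close>. It carries the region of radius 1 onto that of radius
  \<open>t\<close>.\<close>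

lemma measure_face_region:
  fixes P :: "'a::euclidean_space set"
  assumes P: "polytope P" "P \<noteq> {}" and F: "F face_of P" "F \<noteq> {}" and t: "t > 0"
  shows "measure lebesgue (face_region P F t)
       = t ^ (DIM('a) - nat (aff_dim F)) * measure lebesgue (face_region P F 1)"
proof -
  have cP: "convex P" "closed P"
    using P by (auto simp: polytope_imp_convex polytope_imp_closed)
  obtain a where a: "a \<in> F" using F by auto
  let ?T = "span ((+) (- a) ` F)"
  obtain \<pi> where \<pi>: "orth_proj ?T \<pi>" using orth_proj_exists[OF subspace_span] .
  have dimT: "dim ?T = nat (aff_dim F)"
    using aff_dim_eq_dim[OF hull_inc[OF a]] by (simp add: dim_span)
  let ?M = "\<lambda>c x. \<pi> x + c *\<^sub>R (x - \<pi> x)"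
  have eq: "face_region P F t = (+) a ` ?M t ` (+) (- a) ` face_region P F 1"
  proof (intro equalityI subsetI)
    fix y assume y: "y \<in> face_region P F t"
    let ?p = "closest_point P y"
    define x where "x = ?p + (1/t) *\<^sub>R (y - ?p)"
    have px: "closest_point P x = ?p"
      unfolding x_def using cP P t by (intro closest_point_ray) auto
    have "x \<in> face_region P F 1"
      using y t unfolding face_region_def mem_Collect_eq px by (auto simp: x_def)
    moreover have "y = a + ?M t (- a + x)"
    proof -
      have "?p = a + \<pi> (x - a)"
        using closest_point_face_region[OF cP F(1) a \<pi>, of x] y by (simp add: px face_region_def)
      then have "\<pi> (- a + x) = ?p - a" by simp
      then have "a + ?M t (- a + x) = ?p + t *\<^sub>R (x - ?p)" by simp
      then show ?thesis using t by (simp add: x_def)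
    qed
    ultimately show "y \<in> (+) a ` ?M t ` (+) (- a) ` face_region P F 1" by blast
  next
    fix y assume "y \<in> (+) a ` ?M t ` (+) (- a) ` face_region P F 1"
    then obtain x where x: "x \<in> face_region P F 1" "y = a + ?M t (- a + x)" by blast
    let ?p = "closest_point P x"
    have "?p = a + \<pi> (x - a)"
      using closest_point_face_region[OF cP F(1) a \<pi>, of x] x(1) by (simp add: face_region_def)
    then have "\<pi> (- a + x) = ?p - a" by simp
    then have y: "y = ?p + t *\<^sub>R (x - ?p)" using x(2) by simp
    have "closest_point P y = ?p"
      unfolding y using cP P t by (intro closest_point_ray) auto
    then show "y \<in> face_region P F t"
      using x(1) t unfolding face_region_def mem_Collect_eq by (simp add: y)
  qed
  have "measure lebesgue (face_region P F t) = measure lebesgue (?M t ` (+) (- a) ` face_region P F 1)"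
    unfolding eq by (rule measure_translation)
  also have "\<dots> = t ^ (DIM('a) - dim ?T) * measure lebesgue ((+) (- a) ` face_region P F 1)"
    by (intro measure_orth_scaling[OF \<pi> t] borel_translation face_region_borel[OF P F(1)])
  also have "measure lebesgue ((+) (- a) ` face_region P F 1) = measure lebesgue (face_region P F 1)"
    by (rule measure_translation)
  finally show ?thesis unfolding dimT .
qed

text \<open>These are the plain coefficients of the powers of \<open>t\<close>; they still contain
  the unit ball volumes that the intrinsic volumes divide out. Leaving out the empty face, of affine
  dimension -1, makes \<open>nat\<close> harmless.\<close>

definition steiner_poly_coeff :: "'a::euclidean_space set \<Rightarrow> nat \<Rightarrow> real"
  where "steiner_poly_coeff P k =
    (\<Sum>F | F face_of P \<and> F \<noteq> {} \<and> nat (aff_dim F) = k. measure lebesgue (face_region P F 1))"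

lemma closed_nbhd_eq_UN_face_region:
  fixes P :: "'a::euclidean_space set"
  assumes P: "polytope P" "P \<noteq> {}"
  shows "closed_nbhd P t = (\<Union>F\<in>{F. F face_of P \<and> F \<noteq> {}}. face_region P F t)"
proof -
  have cP: "convex P" "closed P"
    using P by (auto simp: polytope_imp_convex polytope_imp_closed)
  have "\<exists>F. F face_of P \<and> F \<noteq> {} \<and> closest_point P y \<in> rel_interior F" for y
    using polytope_face_rel_interior[OF P(1) closest_point_in_set[OF cP(2) P(2), of y]]
    by (metis empty_iff rel_interior_empty)
  then show ?thesis
    using mem_closed_nbhd[OF cP(2) P(2)] by (auto simp: face_region_def) 
qed

text \<open>Faces whose relative interiors meet coincide, so the regions are disjoint. Grouping them
  by the dimension of the face collects equal powers of \<open>t\<close>.\<close>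

lemma measure_closed_nbhd_polytope:
  fixes P :: "'a::euclidean_space set"
  assumes P: "polytope P" "P \<noteq> {}" and t: "t > 0"
  shows "measure lebesgue (closed_nbhd P t) = (\<Sum>k\<le>DIM('a). steiner_poly_coeff P k * t ^ (DIM('a) - k))"
proof -
  let ?\<F> = "{F. F face_of P \<and> F \<noteq> {}}"
  have fin: "finite ?\<F>" using finite_polytope_faces[OF P(1)] by (auto intro: finite_subset[rotated])
  have meas: "face_region P F t \<in> sets lebesgue" "emeasure lebesgue (face_region P F t) \<noteq> \<infinity>"
    if "F face_of P" for F
    using face_region_borel[OF P that, of t] emeasure_bounded_finite[of "face_region P F t"]
    by auto
  have disj: "disjoint_family_on (\<lambda>F. face_region P F t) ?\<F>"
    unfolding disjoint_family_on_def face_region_def using face_of_eq by fastforce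
  have nat_le: "nat (aff_dim F) \<le> DIM('a)" for F :: "'a set"
    using aff_dim_le_DIM[of F] by simp
  have "measure lebesgue (closed_nbhd P t) = (\<Sum>F\<in>?\<F>. measure lebesgue (face_region P F t))"
    unfolding closed_nbhd_eq_UN_face_region[OF P]
    using fin meas disj by (intro measure_finite_Union) auto
  also have "\<dots> = (\<Sum>F\<in>?\<F>. t ^ (DIM('a) - nat (aff_dim F)) * measure lebesgue (face_region P F 1))"
    using measure_face_region[OF P _ _ t] by (intro sum.cong) auto
  also have "\<dots> = (\<Sum>k\<le>DIM('a). \<Sum>F | F \<in> ?\<F> \<and> nat (aff_dim F) = k.
      t ^ (DIM('a) - nat (aff_dim F)) * measure lebesgue (face_region P F 1))"
    using fin nat_le by (intro sum.group[symmetric]) auto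
  also have "\<dots> = (\<Sum>k\<le>DIM('a). steiner_poly_coeff P k * t ^ (DIM('a) - k))"
    by (intro sum.cong) (auto simp: steiner_poly_coeff_def sum_distrib_left mult.commute intro!: sum.cong)
  finally show ?thesis .
qed

subsection \<open>Lower bounds for the coefficients\<close>

text \<open>The limit \<open>s\<close> to 0 in elementary form. It extracts the first-order
  condition at a maximiser from a second-order expansion.\<close>

lemma nonpos_if_le_small_multiples:
  fixes X K :: real
  assumes "\<And>s. 0 < s \<Longrightarrow> s \<le> 1 \<Longrightarrow> X \<le> s * K" "K \<ge> 0"
  shows "X \<le> 0"
proof (rule ccontr)
  assume "\<not> X \<le> 0"
  then have X: "X > 0" by simp
  then have "X \<le> X / (X + K) * K" using assms by (intro assms(1)) auto
  then have "X * (X + K) \<le> X * K" using X assms(2) by (simp add: field_simps)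
  then have "X * X \<le> 0" by (simp add: algebra_simps)
  then show False using X by (simp add: mult_le_0_iff)
qed

text \<open>
  Given a target \<open>w = e + l\<close> with \<open>e\<close> in \<open>E\<close> and \<open>l\<close> orthogonal to it, maximise
  \<open>l \<bullet> z\<close> over \<open>P\<close> with a quadratic penalty of weight \<open>m\<close> on \<open>\<rho> (z - x0) \<noteq> e\<close>.  At a maximiser the
  gradient \<open>l + h\<close> is an outer normal, bounded independently of \<open>m\<close> because of the disc in \<open>P\<close>, and
  \<open>z + l + h\<close> is mapped to within \<open>R / (r m)\<close> of \<open>w\<close>.  Let \<open>m\<close> tend to infinity.
\<close>

lemma mixed_projection_covers_ball:
  fixes P :: "'a::euclidean_space set"
  assumes P: "convex P" "compact P" and E: "orth_proj E \<rho>"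
    and r: "0 < r" "\<And>e. e \<in> E \<Longrightarrow> norm e \<le> 2 * r \<Longrightarrow> x0 + e \<in> P"
    and R: "\<And>x y. x \<in> P \<Longrightarrow> y \<in> P \<Longrightarrow> dist x y \<le> R"
  shows "ball 0 (min r 1) \<subseteq> (\<lambda>y. \<rho> (closest_point P y - x0) + (y - closest_point P y) - \<rho> (y - closest_point P y))
     ` closed_nbhd P (1 + R / r)" (is "_ \<subseteq> ?\<phi> ` ?N")
proof
  fix w :: 'a assume w: "w \<in> ball 0 (min r 1)"
  note \<rho> = orth_proj_simps[OF E]
  have x0: "x0 \<in> P" using r(2)[of 0] subspace_0[OF orth_projD(1)[OF E]] r(1) by simp
  then have ne: "P \<noteq> {}" by auto
  have cl: "closed P" using P compact_imp_closed by blast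
  have lin: "linear \<rho>" using orth_projD(2)[OF E] .
  have cont\<rho>: "continuous_on A \<rho>" for A
    using lin by (simp add: linear_continuous_on linear_linear)
  have cont: "continuous_on ?N ?\<phi>"
    by (intro continuous_intros continuous_on_compose2[OF cont\<rho>[of UNIV]] continuous_on_closest_point[OF P(1) cl ne]) auto
  have closed: "closed (?\<phi> ` ?N)"
    using compact_continuous_image[OF cont compact_closed_nbhd[OF P(2)]] compact_imp_closed by blast
  have R0: "R \<ge> 0" using R[OF x0 x0] by simp
  define e where "e = \<rho> w"
  define l where "l = w - e"
  have e: "e \<in> E" "norm e \<le> r" "\<rho> e = e" and l: "norm l \<le> 1" "\<rho> l = 0"
    using w orth_projD(3)[OF E] orth_proj_norm[OF E, of w] \<rho>
    by (auto simp: e_def l_def)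
  have approx: "\<exists>y\<in>?N. dist (?\<phi> y) w \<le> R / r / m" if m: "m > 0" for m :: real
  proof -
    define g where "g z = l \<bullet> z - m / 2 * (norm (\<rho> (z - x0) - e))\<^sup>2" for z
    have "continuous_on P g"
      unfolding g_def by (intro continuous_intros continuous_on_compose2[OF cont\<rho>[of UNIV]]) auto
    then obtain z where z: "z \<in> P" "\<And>y. y \<in> P \<Longrightarrow> g y \<le> g z"
      using continuous_attains_sup[OF P(2) ne] by blast
    define q where "q = \<rho> (z - x0) - e"
    \<comment> \<open>The gradient of the penalty term at \<open>z\<close>; it equals its own
      projection because \<open>q\<close> lies in \<open>E\<close>.\<close>
    define h where "h = - m *\<^sub>R q"
    have q: "q \<in> E" using e orth_projD(1,3)[OF E] subspace_diff by (auto simp: q_def)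
    have "h \<in> E" unfolding h_def by (rule subspace_scale[OF orth_projD(1)[OF E] q])
    then have h: "h \<in> E" "\<rho> h = h" using \<rho>(1) by auto
    have var: "(l + h) \<bullet> (y - z) \<le> 0" if y: "y \<in> P" for y
    proof (rule nonpos_if_le_small_multiples)
      show "0 \<le> m / 2 * (norm (\<rho> (y - z)))\<^sup>2" using m by simp
      fix s :: real assume s: "0 < s" "s \<le> 1"
      have "z + s *\<^sub>R (y - z) = (1 - s) *\<^sub>R z + s *\<^sub>R y" by (simp add: algebra_simps)
      then have "z + s *\<^sub>R (y - z) \<in> P"
        using convexD[OF P(1) z(1) y, of "1 - s" s] s by simp
      then have "g (z + s *\<^sub>R (y - z)) \<le> g z" by (rule z(2))
      moreover have "\<rho> (z + s *\<^sub>R (y - z) - x0) - e = q + s *\<^sub>R \<rho> (y - z)"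
        unfolding q_def by (simp add: \<rho> algebra_simps)
      ultimately have "s * (l \<bullet> (y - z)) - m / 2 * ((norm (q + s *\<^sub>R \<rho> (y - z)))\<^sup>2 - (norm q)\<^sup>2) \<le> 0"
        unfolding g_def q_def by (simp add: inner_add_right algebra_simps)
      also have "(norm (q + s *\<^sub>R \<rho> (y - z)))\<^sup>2 - (norm q)\<^sup>2
          = 2 * s * (q \<bullet> \<rho> (y - z)) + s * s * (norm (\<rho> (y - z)))\<^sup>2"
        by (simp add: power2_norm_eq_inner inner_add_left inner_add_right inner_commute)
      also have "q \<bullet> \<rho> (y - z) = q \<bullet> (y - z)"
        using orth_proj_inner(1)[OF E, of q "y - z"] \<rho>(1)[OF q] by simp
      finally have "s * ((l + h) \<bullet> (y - z)) \<le> s * (s * (m / 2 * (norm (\<rho> (y - z)))\<^sup>2))"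
        by (simp add: h_def inner_add_left inner_diff_left algebra_simps)
      then show "(l + h) \<bullet> (y - z) \<le> s * (m / 2 * (norm (\<rho> (y - z)))\<^sup>2)"
        using s(1) by (simp only: mult_le_cancel_left_pos)
    qed
    have hR: "norm h \<le> R / r"
    proof (cases "h = 0")
      case True then show ?thesis using R0 r by simp
    next
      case False
      \<comment> \<open>Moving from \<open>e\<close> by \<open>r\<close> in the direction of
        \<open>h\<close> stays within \<open>2 * r\<close> of the origin, so \<open>x0 + u\<close>
        belongs to \<open>P\<close>. Testing \<open>var\<close> there gives
        \<open>r * norm h \<le> R\<close>, whatever \<open>m\<close> is.\<close>
      define u where "u = e + (r / norm h) *\<^sub>R h"
      have u: "u \<in> E" unfolding u_def
        using e h orth_projD(1)[OF E] by (intro subspace_add subspace_scale) auto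
      have "norm u \<le> norm e + r" unfolding u_def
        using norm_triangle_ineq[of e "(r / norm h) *\<^sub>R h"] False r by simp
      then have y: "x0 + u \<in> P" using r(2)[OF u] e by simp
      have "h \<bullet> (x0 + u - z) = h \<bullet> \<rho> (x0 + u - z)"
        using orth_proj_inner(1)[OF E, of h "x0 + u - z"] h by simp
      also have "\<rho> (x0 + u - z) = u - \<rho> (z - x0)"
        using \<rho>(1)[OF u] by (simp add: \<rho> algebra_simps)
      also have "\<dots> = (r / norm h) *\<^sub>R h + (1 / m) *\<^sub>R h"
        using m by (simp add: u_def q_def h_def algebra_simps)
      also have "h \<bullet> \<dots> = r * norm h + (norm h)\<^sup>2 / m"
        using False by (simp add: inner_add_right power2_norm_eq_inner[symmetric] power2_eq_square)
      finally have "h \<bullet> (x0 + u - z) \<ge> r * norm h" using m by simp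
      moreover have "l \<bullet> (x0 + u - z) \<ge> - R"
      proof -
        have "\<bar>l \<bullet> (x0 + u - z)\<bar> \<le> norm l * norm (x0 + u - z)" by (rule Cauchy_Schwarz_ineq2)
        also have "\<dots> \<le> 1 * R"
          using l R[OF y z(1)] by (intro mult_mono) (auto simp: dist_norm)
        finally show ?thesis by simp
      qed
      ultimately have "r * norm h \<le> R" using var[OF y] by (simp add: inner_add_left)
      then show ?thesis using r by (simp add: field_simps)
    qed
    define y where "y = z + (l + h)"
    have py: "closest_point P y = z"
      using P(1) cl z(1) var by (intro closest_point_eqI) (auto simp: y_def)
    have "norm (l + h) \<le> 1 + R / r" using norm_triangle_ineq[of l h] l hR by simp
    then have "y \<in> ?N" using mem_closed_nbhd[OF cl ne, of y] py by (simp add: y_def)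
    \<comment> \<open>The part \<open>h\<close> of \<open>y - z\<close> lies in \<open>E\<close> and
      is cancelled by the last term of the map. The only error left is \<open>q\<close>, of size
      \<open>norm h / m\<close>.\<close>
    moreover have "?\<phi> y - w = q"
      unfolding py using l h e by (simp add: y_def \<rho> q_def l_def)
    moreover have "norm q \<le> R / r / m"
    proof -
      have "norm h = norm q * m" using m by (simp add: h_def)
      then show ?thesis using hR by (simp only: pos_le_divide_eq[OF m])
    qed
    ultimately show ?thesis by (intro bexI[of _ y]) (simp_all add: dist_norm)
  qed
  show "w \<in> ?\<phi> ` ?N"
  proof (rule closed_approachable[THEN iffD1, OF closed], intro allI impI)
    fix \<epsilon> :: real assume \<epsilon>: "\<epsilon> > 0"
    define m where "m = (R / r + 1) / \<epsilon>"
    have m: "m > 0" using \<epsilon> R0 r by (simp add: m_def add_nonneg_pos)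
    obtain y where y: "y \<in> ?N" "dist (?\<phi> y) w \<le> R / r / m" using approx[OF m] by blast
    have "R / r < \<epsilon> * m" using \<epsilon> by (simp add: m_def)
    then have "R / r / m < \<epsilon>" by (simp only: pos_divide_less_eq[OF m])
    then show "\<exists>y\<in>?\<phi> ` ?N. dist y w < \<epsilon>" using y by force
  qed
qed

lemma dim_orthogonal_complement:
  fixes S :: "'a::euclidean_space set"
  assumes "subspace S"
  shows "subspace {y. \<forall>x\<in>S. orthogonal x y}" "dim {y. \<forall>x\<in>S. orthogonal x y} + dim S = DIM('a)"
  using dim_subspace_orthogonal_to_vectors[OF assms subspace_UNIV subset_UNIV]
  by (simp_all add: subspace_orthogonal_to_vectors)

text \<open>On the region of \<open>F\<close> the nearest-point map is affine, so the mixed map is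
  affine with linear part \<open>G\<close>. This sends the directions of \<open>F\<close> into
  \<open>E\<close> and those orthogonal to \<open>F\<close> into the complement of \<open>E\<close>,
  which costs rank unless the dimensions agree. Since \<open>G\<close> at most doubles norms, it
  multiplies volume by at most \<open>2 ^ DIM('a)\<close>.\<close>

lemma mixed_projection_face_region:
  fixes P :: "'a::euclidean_space set" and x0 :: 'a
  assumes P: "polytope P" "P \<noteq> {}" and F: "F face_of P" "F \<noteq> {}" and E: "orth_proj E \<rho>"
  defines "\<phi> \<equiv> (\<lambda>y. \<rho> (closest_point P y - x0) + (y - closest_point P y) - \<rho> (y - closest_point P y))"
  shows "nat (aff_dim F) \<noteq> dim E \<Longrightarrow> negligible (\<phi> ` face_region P F t)"
    and "\<phi> ` face_region P F t \<in> lmeasurable"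
    and "measure lebesgue (\<phi> ` face_region P F t) \<le> 2 ^ DIM('a) * measure lebesgue (face_region P F t)"
proof -
  have cP: "convex P" "closed P"
    using P by (auto simp: polytope_imp_convex polytope_imp_closed)
  note \<rho> = orth_proj_simps[OF E]
  obtain a where a: "a \<in> F" using F by auto
  let ?T = "span ((+) (- a) ` F)"
  obtain \<pi> where \<pi>: "orth_proj ?T \<pi>" using orth_proj_exists[OF subspace_span] .
  have dimT: "dim ?T = nat (aff_dim F)"
    using aff_dim_eq_dim[OF hull_inc[OF a]] by (simp add: dim_span)
  define G where "G x = \<rho> (\<pi> x) + (x - \<pi> x) - \<rho> (x - \<pi> x)" for x
  have linG: "linear G"
    unfolding G_def using orth_projD(2)[OF \<pi>] orth_projD(2)[OF E]
    by (intro linear_compose_add linear_compose_sub linear_id[unfolded id_def]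
        linear_compose[of \<pi> \<rho>, unfolded o_def] linear_compose[of "\<lambda>x. x - \<pi> x" \<rho>, unfolded o_def])
  have \<phi>G: "\<phi> y = \<rho> (a - x0) + G (- a + y)" if "y \<in> face_region P F t" for y
  proof -
    have "closest_point P y = a + \<pi> (y - a)"
      using that closest_point_face_region[OF cP F(1) a \<pi>, of y] by (simp add: face_region_def)
    then show ?thesis by (simp add: \<phi>_def G_def \<rho> algebra_simps)
  qed
  have im: "\<phi> ` face_region P F t = (+) (\<rho> (a - x0)) ` G ` (+) (- a) ` face_region P F t"
    unfolding image_image using \<phi>G by (intro image_cong) auto
  have normG: "norm (G x) \<le> 2 * norm x" for x
  proof -
    have "norm (G x) \<le> norm (\<rho> (\<pi> x)) + norm ((x - \<pi> x) - \<rho> (x - \<pi> x))"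
      unfolding G_def by (metis add_diff_eq norm_triangle_ineq)
    also have "\<dots> \<le> norm x + norm x"
      using orth_proj_norm[OF E] orth_proj_norm[OF \<pi>] by (intro add_mono) (meson order_trans)+
    finally show ?thesis by simp
  qed
  have X: "(+) (- a) ` face_region P F t \<in> sets borel" "bounded ((+) (- a) ` face_region P F t)"
    using borel_translation[OF face_region_borel(1)[OF P F(1)]]
      bounded_translation[OF face_region_borel(2)[OF P F(1)]] by blast+
  have G: "G ` (+) (- a) ` face_region P F t \<in> lmeasurable"
    "measure lebesgue (G ` (+) (- a) ` face_region P F t) \<le> 2 ^ DIM('a) * measure lebesgue ((+) (- a) ` face_region P F t)"
    using linear_image_measure_le[OF linG normG _ X] by simp_all
  show "\<phi> ` face_region P F t \<in> lmeasurable"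
    unfolding im using G(1) by (rule measurable_translation)
  show "measure lebesgue (\<phi> ` face_region P F t) \<le> 2 ^ DIM('a) * measure lebesgue (face_region P F t)"
    unfolding im measure_translation using G(2) unfolding measure_translation .
  assume ne: "nat (aff_dim F) \<noteq> dim E"
  let ?T' = "{y. \<forall>x\<in>?T. orthogonal x y}" and ?E' = "{y. \<forall>x\<in>E. orthogonal x y}"
  let ?\<rho>' = "\<lambda>x. x - \<rho> x"
  have lin\<rho>': "linear ?\<rho>'"
    using orth_projD(2)[OF E] by (intro linear_compose_sub linear_id[unfolded id_def])
  let ?W1 = "\<rho> ` ?T" and ?W2 = "?\<rho>' ` ?T'"
  note T' = dim_orthogonal_complement[OF subspace_span, of "(+) (- a) ` F"]
  note E' = dim_orthogonal_complement[OF orth_projD(1)[OF E]]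
  have sub: "subspace ?W1" "subspace ?W2"
    using linear_subspace_image[OF orth_projD(2)[OF E] subspace_span] linear_subspace_image[OF lin\<rho>' T'(1)]
    by auto
  have "dim ?W1 \<le> dim ?T" "dim ?W2 \<le> dim ?T'"
    by (rule dim_image_le[OF orth_projD(2)[OF E]], rule dim_image_le[OF lin\<rho>'])
  moreover have "dim ?W1 \<le> dim E" "dim ?W2 \<le> dim ?E'"
    using orth_projD(3,4)[OF E] by (auto intro!: dim_subset simp: orthogonal_def inner_commute)
  moreover have "dim {x + y |x y. x \<in> ?W1 \<and> y \<in> ?W2} \<le> dim ?W1 + dim ?W2"
    using dim_sums_Int[OF sub] by simp
  \<comment> \<open>The summands have dimension at most min(dim T, dim E) and min(d - dim T, d - dim
    E). These add up to d only if the two dimensions are equal.\<close>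
  ultimately have "dim {x + y |x y. x \<in> ?W1 \<and> y \<in> ?W2} < DIM('a)"
    using ne T'(2) E'(2) dimT by linarith
  then have neg: "negligible {x + y |x y. x \<in> ?W1 \<and> y \<in> ?W2}" by (rule negligible_lowdim)
  have "G x \<in> {x + y |x y. x \<in> ?W1 \<and> y \<in> ?W2}" for x
  proof -
    have "x - \<pi> x \<in> ?T'" using orth_projD(4)[OF \<pi>] by (auto simp: orthogonal_def inner_commute)
    moreover have "\<pi> x \<in> ?T" using orth_projD(3)[OF \<pi>] .
    moreover have "G x = \<rho> (\<pi> x) + ?\<rho>' (x - \<pi> x)" by (simp add: G_def)
    ultimately show ?thesis by blast
  qed
  then have "negligible (G ` (+) (- a) ` face_region P F t)"
    by (intro negligible_subset[OF neg]) blast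
  then show "negligible (\<phi> ` face_region P F t)"
    unfolding im by (rule negligible_translation)
qed

lemma steiner_poly_coeff_nonneg: "steiner_poly_coeff P k \<ge> 0"
  by (auto simp: steiner_poly_coeff_def intro: sum_nonneg)

text \<open>The images of the regions cover a ball, and only faces of dimension \<open>dim E\<close>
  have images of positive measure. The bound sees \<open>P\<close> only through \<open>r\<close> and
  \<open>R\<close>, not through its faces, so it passes to limits of polytopes.\<close>

lemma steiner_poly_coeff_lower_bound:
  fixes P :: "'a::euclidean_space set"
  assumes P: "polytope P" and E: "subspace E"
    and r: "0 < r" "\<And>e. e \<in> E \<Longrightarrow> norm e \<le> 2 * r \<Longrightarrow> x0 + e \<in> P"
    and R: "\<And>x y. x \<in> P \<Longrightarrow> y \<in> P \<Longrightarrow> dist x y \<le> R"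
  shows "measure lebesgue (ball (0::'a) (min r 1))
       \<le> 2 ^ DIM('a) * (1 + R / r) ^ (DIM('a) - dim E) * steiner_poly_coeff P (dim E)"
proof -
  obtain \<rho> where \<rho>: "orth_proj E \<rho>" using orth_proj_exists[OF E] .
  have x0: "x0 \<in> P" using r(2)[of 0] subspace_0[OF E] r(1) by simp
  then have ne: "P \<noteq> {}" by auto
  have R0: "R \<ge> 0" using R[OF x0 x0] by simp
  define \<phi> where "\<phi> = (\<lambda>y. \<rho> (closest_point P y - x0) + (y - closest_point P y) - \<rho> (y - closest_point P y))"
  let ?C = "1 + R / r"
  let ?\<F> = "{F. F face_of P \<and> F \<noteq> {}}"
  have C: "?C > 0" using R0 r(1) by (simp add: add_pos_nonneg)
  have fin: "finite ?\<F>" using finite_polytope_faces[OF P(1)] by (auto intro: finite_subset[rotated])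
  note img = mixed_projection_face_region[OF P ne _ _ \<rho>, where ?x0.0=x0, folded \<phi>_def]
  have zero: "measure lebesgue (\<phi> ` face_region P F ?C) = 0"
    if "F face_of P" "F \<noteq> {}" "nat (aff_dim F) \<noteq> dim E" for F
    using negligible_imp_measure0[OF img(1)[OF that]] .
  have "ball 0 (min r 1) \<subseteq> \<phi> ` closed_nbhd P ?C"
    unfolding \<phi>_def using P r R
    by (intro mixed_projection_covers_ball[OF _ _ \<rho>]) (auto simp: polytope_imp_convex polytope_imp_compact)
  also have "\<dots> = (\<Union>F\<in>?\<F>. \<phi> ` face_region P F ?C)"
    unfolding closed_nbhd_eq_UN_face_region[OF P ne] by (simp add: image_UN)
  finally have sub: "ball 0 (min r 1) \<subseteq> (\<Union>F\<in>?\<F>. \<phi> ` face_region P F ?C)" .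
  have "measure lebesgue (ball (0::'a) (min r 1)) \<le> measure lebesgue (\<Union>F\<in>?\<F>. \<phi> ` face_region P F ?C)"
    using fin img(2) by (intro measure_mono_fmeasurable[OF sub] fmeasurable.finite_UN) auto
  also have "\<dots> \<le> (\<Sum>F\<in>?\<F>. measure lebesgue (\<phi> ` face_region P F ?C))"
    using fin img(2) by (intro measure_UNION_le) (auto simp: fmeasurableD)
  also have "\<dots> = (\<Sum>F | F \<in> ?\<F> \<and> nat (aff_dim F) = dim E. measure lebesgue (\<phi> ` face_region P F ?C))"
    using fin zero by (intro sum.mono_neutral_right) auto
  also have "\<dots> \<le> (\<Sum>F | F \<in> ?\<F> \<and> nat (aff_dim F) = dim E.
      2 ^ DIM('a) * ?C ^ (DIM('a) - dim E) * measure lebesgue (face_region P F 1))"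
  proof (rule sum_mono)
    fix F assume F: "F \<in> {F. F \<in> ?\<F> \<and> nat (aff_dim F) = dim E}"
    then have "measure lebesgue (\<phi> ` face_region P F ?C) \<le> 2 ^ DIM('a) * measure lebesgue (face_region P F ?C)"
      by (intro img(3)) auto
    also have "measure lebesgue (face_region P F ?C) = ?C ^ (DIM('a) - dim E) * measure lebesgue (face_region P F 1)"
      using measure_face_region[OF P ne _ _ C, of F] F by auto
    finally show "measure lebesgue (\<phi> ` face_region P F ?C)
        \<le> 2 ^ DIM('a) * ?C ^ (DIM('a) - dim E) * measure lebesgue (face_region P F 1)" by simp
  qed
  also have "\<dots> = 2 ^ DIM('a) * ?C ^ (DIM('a) - dim E) * steiner_poly_coeff P (dim E)"
    by (simp add: steiner_poly_coeff_def sum_distrib_left conj_assoc)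
  finally show ?thesis .
qed

subsection \<open>Compact convex sets\<close>

text \<open>Bolzano-Weierstrass for one index at a time, each time refining the previous
  subsequence.\<close>

lemma simultaneous_convergent_subsequence:
  fixes f :: "'i \<Rightarrow> nat \<Rightarrow> real"
  assumes "finite I" "\<And>k n. k \<in> I \<Longrightarrow> \<bar>f k n\<bar> \<le> B"
  shows "\<exists>r :: nat \<Rightarrow> nat. strict_mono r \<and> (\<forall>k\<in>I. convergent (\<lambda>n. f k (r n)))"
  using assms
proof (induction I rule: finite_induct)
  case empty
  then show ?case by (auto intro: exI[of _ id] simp: strict_mono_id[unfolded id_def] id_def strict_mono_def)
next
  case (insert i I)
  then obtain r :: "nat \<Rightarrow> nat" where r: "strict_mono r" "\<And>k. k \<in> I \<Longrightarrow> convergent (\<lambda>n. f k (r n))"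
    by auto
  have "bounded (range (\<lambda>n. f i (r n)))"
    using insert.prems by (auto simp: bounded_iff)
  then obtain l s where s: "strict_mono s" "((\<lambda>n. f i (r n)) \<circ> s) \<longlonglongrightarrow> l"
    using bounded_imp_convergent_subsequence by blast
  have "convergent (\<lambda>n. f k (r (s n)))" if "k \<in> insert i I" for k
  proof (cases "k = i")
    case True
    then show ?thesis using s(2) by (auto simp: convergent_def o_def)
  next
    case False
    then have "convergent ((\<lambda>n. f k (r n)) \<circ> s)"
      using r(2) that convergent_subseq_convergent[OF _ s(1)] by blast
    then show ?thesis by (simp add: o_def)
  qed
  then show ?case using strict_mono_o[OF r(1) s(1)]
    by (intro exI[of _ "r \<circ> s"]) (auto simp: o_def)
qed

lemma closed_nbhd_mono: "S \<subseteq> T \<Longrightarrow> s \<le> t \<Longrightarrow> closed_nbhd S s \<subseteq> closed_nbhd T t"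
  unfolding closed_nbhd_def by force

lemma closed_nbhd_closed_nbhd: "closed_nbhd (closed_nbhd S s) t \<subseteq> closed_nbhd S (s + t)"
proof
  fix y assume "y \<in> closed_nbhd (closed_nbhd S s) t"
  then obtain z u v where "z \<in> S" "norm u \<le> s" "norm v \<le> t" "y = z + (u + v)"
    by (auto simp: closed_nbhd_def add.assoc)
  then show "y \<in> closed_nbhd S (s + t)"
    using norm_triangle_ineq[of u v] by (force simp: closed_nbhd_def)
qed

text \<open>Inscribed polytopes \<open>P n\<close> come within \<open>1 / Suc n\<close> of
  \<open>K\<close>, so neighbourhood volumes of \<open>K\<close> are squeezed between values of
  their Steiner polynomials. The coefficients are bounded, and a subsequence of them converges to
  \<open>c\<close>; positivity follows from a lower bound uniform in \<open>n\<close>.\<close>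

lemma compact_convex_steiner_polynomial:
  fixes K :: "'a::euclidean_space set"
  assumes K: "compact K" "convex K" "K \<noteq> {}"
  obtains c where "\<And>k. k \<le> DIM('a) \<Longrightarrow> 0 \<le> c k"
    and "\<And>t. t > 0 \<Longrightarrow> measure lebesgue (closed_nbhd K t) = (\<Sum>k\<le>DIM('a). c k * t ^ (DIM('a) - k))"
    and "\<And>k. int k \<le> aff_dim K \<Longrightarrow> 0 < c k"
proof -
  let ?d = "DIM('a)" and ?m = "\<lambda>S. measure lebesgue (S :: 'a set)"
  \<comment> \<open>\<open>S0\<close> goes into every \<open>P n\<close>, so that all these
    polytopes share one relatively open piece of the affine hull of \<open>K\<close>, and with it a
    fixed disc of each admissible dimension.\<close>
  obtain S0 where S0: "S0 \<subseteq> K" "finite S0" "affine hull K = affine hull S0"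
    using affine_basis_exists[of K] aff_independent_finite by metis
  have "\<exists>T. finite T \<and> T \<subseteq> K \<and> K \<subseteq> (\<Union>x\<in>T. ball x (1 / real (Suc n)))" for n
    by (rule compactE_image[OF K(1), of K "\<lambda>x. ball x (1 / real (Suc n))"]) auto
  then obtain T where T: "\<And>n. finite (T n)" "\<And>n. T n \<subseteq> K"
      "\<And>n. K \<subseteq> (\<Union>x\<in>T n. ball x (1 / real (Suc n)))"
    by metis
  define P where "P n = convex hull (S0 \<union> T n)" for n
  have P: "polytope (P n)" for n
    unfolding P_def polytope_def using S0 T by blast
  have PK: "P n \<subseteq> K" for n
    unfolding P_def using S0 T K(2) by (intro hull_minimal) auto
  have TP: "T n \<subseteq> P n" and S0P: "convex hull S0 \<subseteq> P n" for n
    unfolding P_def using hull_subset[of "S0 \<union> T n" convex] hull_mono[of S0 "S0 \<union> T n" convex] by auto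
  have KP: "K \<subseteq> closed_nbhd (P n) (1 / real (Suc n))" for n
  proof
    fix x assume "x \<in> K"
    then obtain z where "z \<in> T n" "dist z x < 1 / real (Suc n)" using T(3)[of n] by auto
    then have "x = z + (x - z)" "z \<in> P n" "norm (x - z) \<le> 1 / real (Suc n)"
      using TP[of n] by (auto simp: dist_norm norm_minus_commute)
    then show "x \<in> closed_nbhd (P n) (1 / real (Suc n))"
      unfolding closed_nbhd_def by blast
  qed
  have Pne: "P n \<noteq> {}" for n using KP[of n] K(3) by (auto simp: closed_nbhd_def)
  have lm: "closed_nbhd S t \<in> lmeasurable" if "compact S" for S :: "'a set" and t
    using compact_closed_nbhd[OF that] lmeasurable_compact by blast
  have Pc: "compact (P n)" for n using P polytope_imp_compact by blast
  define a where "a k n = steiner_poly_coeff (P n) k" for k n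
  define q where "q n t = (\<Sum>k\<le>?d. a k n * t ^ (?d - k))" for n t
  have a0: "a k n \<ge> 0" for k n by (simp add: a_def steiner_poly_coeff_nonneg)
  have qP: "?m (closed_nbhd (P n) t) = q n t" if "t > 0" for n t
    using measure_closed_nbhd_polytope[OF P Pne that] by (simp add: q_def a_def)
  have lower: "q n t \<le> ?m (closed_nbhd K t)" if "t > 0" for n t
    unfolding qP[OF that, symmetric]
    using lm[OF K(1)] lm[OF Pc]
    by (intro measure_mono_fmeasurable closed_nbhd_mono PK) (auto simp: fmeasurableD)
  \<comment> \<open>\<open>K\<close> lies in the \<open>1 / Suc n\<close>-neighbourhood of
    \<open>P n\<close>, so the radii add by the triangle inequality.\<close>
  have upper: "?m (closed_nbhd K t) \<le> q n (1 / real (Suc n) + t)" if "t > 0" for n t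
  proof -
    have "closed_nbhd K t \<subseteq> closed_nbhd (P n) (1 / real (Suc n) + t)"
      using closed_nbhd_mono[OF KP order_refl] closed_nbhd_closed_nbhd by blast
    moreover have "1 / real (Suc n) + t > 0" using that by (simp add: add_pos_pos)
    ultimately show ?thesis
      using lm[OF K(1)] lm[OF Pc] qP[of "1 / real (Suc n) + t" n]
        measure_mono_fmeasurable[of "closed_nbhd K t" "closed_nbhd (P n) (1 / real (Suc n) + t)" lebesgue]
      by (auto simp: fmeasurableD)
  qed
  \<comment> \<open>At \<open>t = 1\<close> the polynomial is the sum of its nonnegative
    coefficients and bounds each of them.\<close>
  have bd: "\<bar>a k n\<bar> \<le> ?m (closed_nbhd K 1)" if "k \<in> {..?d}" for k n
  proof -
    have "a k n \<le> q n 1"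
      using member_le_sum[of k "{..?d}" "\<lambda>k. a k n"] that a0 by (simp add: q_def)
    then show ?thesis using lower[of 1 n] a0[of k n] by simp
  qed
  obtain r :: "nat \<Rightarrow> nat" where r: "strict_mono r" "\<And>k. k \<le> ?d \<Longrightarrow> convergent (\<lambda>n. a k (r n))"
    using simultaneous_convergent_subsequence[of "{..?d}" a "?m (closed_nbhd K 1)"] bd by auto
  define c where "c k = lim (\<lambda>n. a k (r n))" for k
  have c: "(\<lambda>n. a k (r n)) \<longlonglongrightarrow> c k" if "k \<le> ?d" for k
    using r(2)[OF that] by (simp add: c_def convergent_LIMSEQ_iff)
  have "(\<lambda>n. 1 / real (Suc n)) \<longlonglongrightarrow> 0" using LIMSEQ_inverse_real_of_nat by (simp add: inverse_eq_divide)
  from LIMSEQ_subseq_LIMSEQ[OF this r(1)] have r0: "(\<lambda>n. 1 / real (Suc (r n))) \<longlonglongrightarrow> 0"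
    by (simp only: o_def)
  show ?thesis
  proof
    show "0 \<le> c k" if "k \<le> ?d" for k
      using LIMSEQ_le_const[OF c[OF that]] a0 by blast
    show "?m (closed_nbhd K t) = (\<Sum>k\<le>?d. c k * t ^ (?d - k))" if "t > 0" for t
    proof (rule antisym)
      have "(\<lambda>n. q (r n) (1 / real (Suc (r n)) + t)) \<longlonglongrightarrow> (\<Sum>k\<le>?d. c k * (0 + t) ^ (?d - k))"
        unfolding q_def using c by (intro tendsto_intros r0) auto
      then show "?m (closed_nbhd K t) \<le> (\<Sum>k\<le>?d. c k * t ^ (?d - k))"
        using upper[OF that] LIMSEQ_le_const[of _ "\<Sum>k\<le>?d. c k * t ^ (?d - k)"] by simp
      have "(\<lambda>n. q (r n) t) \<longlonglongrightarrow> (\<Sum>k\<le>?d. c k * t ^ (?d - k))"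
        unfolding q_def using c by (intro tendsto_intros) auto
      then show "(\<Sum>k\<le>?d. c k * t ^ (?d - k)) \<le> ?m (closed_nbhd K t)"
        using lower[OF that] by (intro LIMSEQ_le_const2) auto
    qed
    show "0 < c k" if k: "int k \<le> aff_dim K" for k
    proof -
      have kd: "k \<le> ?d" using k aff_dim_le_DIM[of K] by simp
      let ?Q = "convex hull S0"
      have affQ: "affine hull ?Q = affine hull K" using S0 by (simp add: affine_hull_convex_hull)
      have "S0 \<noteq> {}" using S0(3) K(3) by (metis affine_hull_eq_empty)
      then have "rel_interior ?Q \<noteq> {}" by (simp add: rel_interior_eq_empty convex_convex_hull)
      then obtain x0 where "x0 \<in> rel_interior ?Q" by blast
      then obtain e where x0: "x0 \<in> ?Q" and e: "e > 0" "cball x0 e \<inter> affine hull ?Q \<subseteq> ?Q"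
        by (auto simp: mem_rel_interior_cball)
      let ?D = "span ((+) (- x0) ` ?Q)"
      have "aff_dim ?Q = aff_dim K" using affQ aff_dim_affine_hull by metis
      then have "k \<le> dim ?D"
        using k aff_dim_eq_dim[OF hull_inc[OF x0, of affine]] by simp
      then obtain E where E: "subspace E" "E \<subseteq> ?D" "dim E = k"
        by (metis choose_subspace_of_subspace span_span)
      obtain R where R: "\<And>x y. x \<in> K \<Longrightarrow> y \<in> K \<Longrightarrow> dist x y \<le> R"
        using compact_imp_bounded[OF K(1)] bounded_two_points by metis
      \<comment> \<open>The lower bound asks for a disc of radius \<open>2 * s\<close>, which is
        \<open>e\<close>.\<close>
      define s where "s = e / 2"
      have s: "s > 0" using e by (simp add: s_def)
      have PE: "x0 + u \<in> P n" if "u \<in> E" "norm u \<le> 2 * s" for u n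
      proof -
        have "(+) (- x0) ` ?Q = insert 0 ((+) (- x0) ` (?Q - {x0}))" using x0 by force
        then have "affine hull ?Q = (+) x0 ` ?D"
          using affine_hull_span2[OF x0] span_insert_0 by metis
        then have "x0 + u \<in> affine hull ?Q" using that E by blast
        moreover have "x0 + u \<in> cball x0 e" using that by (simp add: s_def dist_norm)
        ultimately show ?thesis using e S0P by blast
      qed
      have RP: "dist x y \<le> R" if "x \<in> P n" "y \<in> P n" for x y n
        using that PK R by blast
      have "?m (ball 0 (min s 1)) \<le> 2 ^ ?d * (1 + R / s) ^ (?d - k) * a k n" for n
        using steiner_poly_coeff_lower_bound[OF P E(1) s PE RP, of n] by (simp only: a_def E(3))
      then have "?m (ball 0 (min s 1)) \<le> 2 ^ ?d * (1 + R / s) ^ (?d - k) * c k"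
        by (intro LIMSEQ_le_const[OF tendsto_mult_left[OF c[OF kd]]]) blast
      moreover have "?m (ball 0 (min s 1)) > 0"
        using content_ball_pos[of "min s 1" "0::'a"] s by (simp add: measure_completion)
      ultimately have "c k \<noteq> 0" by (metis mult_zero_right linorder_not_le)
      moreover have "c k \<ge> 0" using LIMSEQ_le_const[OF c[OF kd]] a0 by blast
      ultimately show ?thesis by simp
    qed
  qed
qed

subsection \<open>Intrinsic volumes\<close>

lemma emeasure_closed_nbhd:
  fixes K :: "'a::euclidean_space set"
  assumes "compact K"
  shows "emeasure lborel (closed_nbhd K t) = ennreal (measure lebesgue (closed_nbhd K t))"
    "measure lborel (closed_nbhd K t) = measure lebesgue (closed_nbhd K t)"
proof -
  have c: "compact (closed_nbhd K t)" by (rule compact_closed_nbhd[OF assms])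
  then have "closed_nbhd K t \<in> sets lborel" using borel_compact by simp
  then show "measure lborel (closed_nbhd K t) = measure lebesgue (closed_nbhd K t)"
    by (simp add: measure_completion)
  then show "emeasure lborel (closed_nbhd K t) = ennreal (measure lebesgue (closed_nbhd K t))"
    using emeasure_compact_finite[OF c] emeasure_eq_ennreal_measure by (metis infinity_ennreal_def less_irrefl)
qed

text \<open>The difference polynomial vanishes on the whole positive half-line, while a nonzero one
  has finitely many roots. Its coefficients are reversed in \<open>e\<close> to get ascending
  powers.\<close>

lemma steiner_polynomial_coeffs_unique:
  fixes c c' :: "nat \<Rightarrow> real"
  assumes "\<And>t. t > 0 \<Longrightarrow> (\<Sum>k\<le>d. c k * t ^ (d - k)) = (\<Sum>k\<le>d. c' k * t ^ (d - k))" "k \<le> d"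
  shows "c k = c' k"
proof (rule ccontr)
  assume "c k \<noteq> c' k"
  define e where "e i = c (d - i) - c' (d - i)" for i
  have "e (d - k) \<noteq> 0" using \<open>c k \<noteq> c' k\<close> assms(2) by (simp add: e_def)
  then have "finite {t. (\<Sum>i\<le>d. e i * t ^ i) = 0}"
    using polyfun_finite_roots[where c = e and n = d] by (metis diff_le_self)
  moreover have "{0<..} \<subseteq> {t. (\<Sum>i\<le>d. e i * t ^ i) = 0}"
  proof
    fix t :: real assume t: "t \<in> {0<..}"
    have "(\<Sum>i\<le>d. e i * t ^ i) = (\<Sum>k\<le>d. (c k - c' k) * t ^ (d - k))"
      by (rule sum.reindex_bij_witness[of _ "\<lambda>i. d - i" "\<lambda>i. d - i"]) (auto simp: e_def)
    also have "\<dots> = 0" using assms(1)[of t] t by (simp add: left_diff_distrib sum_subtractf)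
    finally show "t \<in> {t. (\<Sum>i\<le>d. e i * t ^ i) = 0}" by simp
  qed
  ultimately show False using infinite_Ioi finite_subset by blast
qed

text \<open>Justifies the definite description for compact sets. Prescribing 0 beyond the dimension
  makes \<open>V\<close> unique as a function, not only on the indices of the formula.\<close>

lemma The_steiner_coeffs:
  fixes K :: "'a::euclidean_space set"
  assumes K: "compact K"
    and c0: "\<And>k. k \<le> DIM('a) \<Longrightarrow> 0 \<le> c k"
    and c: "\<And>t. t > 0 \<Longrightarrow> measure lebesgue (closed_nbhd K t) = (\<Sum>k\<le>DIM('a). c k * t ^ (DIM('a) - k))"
    and k: "k \<le> DIM('a)"
  shows "(THE V. steiner_coeffs K V) k = ennreal (c k / unit_ball_vol (real (DIM('a) - k)))"
proof -
  let ?d = "DIM('a)"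
  define \<kappa> where "\<kappa> k = unit_ball_vol (real (?d - k))" for k
  have \<kappa>: "\<kappa> k > 0" for k by (simp add: \<kappa>_def)
  then have \<kappa>0: "\<kappa> k \<ge> 0" for k by (rule less_imp_le)
  define W where "W k = (if k \<le> ?d then ennreal (c k / \<kappa> k) else 0)" for k
  have W: "steiner_coeffs K W"
    unfolding steiner_coeffs_def
  proof (intro conjI allI impI)
    fix t :: real assume t: "t > 0"
    have "emeasure lborel (closed_nbhd K t) = ennreal (\<Sum>k\<le>?d. \<kappa> k * (c k / \<kappa> k) * t ^ (?d - k))"
      using less_imp_neq[OF \<kappa>] by (simp add: emeasure_closed_nbhd(1)[OF K] c[OF t])
    also have "\<dots> = (\<Sum>k\<le>?d. ennreal (\<kappa> k * (c k / \<kappa> k) * t ^ (?d - k)))"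
      using c0 \<kappa>0 t
      by (intro sum_ennreal[symmetric] mult_nonneg_nonneg divide_nonneg_nonneg) auto
    also have "\<dots> = (\<Sum>k\<le>?d. ennreal (\<kappa> k) * W k * ennreal (t ^ (?d - k)))"
    proof (rule sum.cong)
      fix k assume "k \<in> {..?d}"
      then have "c k / \<kappa> k \<ge> 0" "W k = ennreal (c k / \<kappa> k)"
        using c0[of k] \<kappa>[of k] by (auto simp: W_def)
      then show "ennreal (\<kappa> k * (c k / \<kappa> k) * t ^ (?d - k)) = ennreal (\<kappa> k) * W k * ennreal (t ^ (?d - k))"
        using \<kappa>[of k] t by (simp only: ennreal_mult mult_nonneg_nonneg less_imp_le zero_le_power)
    qed simp
    finally show "emeasure lborel (closed_nbhd K t) =
      (\<Sum>k\<le>?d. ennreal (unit_ball_vol (real (?d - k))) * W k * ennreal (t ^ (?d - k)))"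
      by (simp add: \<kappa>_def)
  qed (simp add: W_def)
  have "V = W" if V: "steiner_coeffs K V" for V
  proof
    fix k
    have VK: "ennreal (\<Sum>k\<le>?d. c k * t ^ (?d - k)) = (\<Sum>k\<le>?d. ennreal (\<kappa> k) * V k * ennreal (t ^ (?d - k)))"
      if "t > 0" for t
      using V that by (simp add: steiner_coeffs_def \<kappa>_def c[OF that, symmetric] emeasure_closed_nbhd(1)[OF K])
    \<comment> \<open>Coefficients can be compared as reals only once they are finite: an infinite
      one would make the finite volume at \<open>t = 1\<close> infinite.\<close>
    have fin: "V k \<noteq> top" if "k \<le> ?d" for k
    proof
      assume "V k = top"
      then have "ennreal (\<kappa> k) * V k * ennreal (1 ^ (?d - k)) = top"
        using \<kappa>[of k] by (simp add: ennreal_mult_top)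
      then have "(\<Sum>k\<le>?d. ennreal (\<kappa> k) * V k * ennreal (1 ^ (?d - k))) = top"
        using that by (subst ennreal_sum_eq_top) auto
      then show False using VK[of 1] by (metis ennreal_neq_top zero_less_one)
    qed
    define v where "v k = enn2real (V k)" for k
    have v: "V k = ennreal (v k)" if "k \<le> ?d" for k
      using fin[OF that] by (simp add: v_def ennreal_enn2real_if)
    have v0: "v k \<ge> 0" for k by (simp add: v_def)
    have "c k = \<kappa> k * v k" if "k \<le> ?d" for k
    proof (rule steiner_polynomial_coeffs_unique[OF _ that])
      fix t :: real assume t: "t > 0"
      have "ennreal (\<Sum>k\<le>?d. c k * t ^ (?d - k)) = (\<Sum>k\<le>?d. ennreal (\<kappa> k * v k * t ^ (?d - k)))"
        unfolding VK[OF t] using v v0 less_imp_le[OF \<kappa>] t by (intro sum.cong) (auto simp: ennreal_mult)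
      also have "\<dots> = ennreal (\<Sum>k\<le>?d. \<kappa> k * v k * t ^ (?d - k))"
        using v0 \<kappa>0 t by (intro sum_ennreal mult_nonneg_nonneg) auto
      finally show "(\<Sum>k\<le>?d. c k * t ^ (?d - k)) = (\<Sum>k\<le>?d. \<kappa> k * v k * t ^ (?d - k))"
        using v0 c0 \<kappa>0 t
        by (subst (asm) ennreal_inj) (auto intro!: sum_nonneg mult_nonneg_nonneg)
    qed
    then show "V k = W k"
      using v V \<kappa>[of k] by (auto simp: W_def steiner_coeffs_def)
  qed
  then have "(THE V. steiner_coeffs K V) = W" using W by blast
  then show ?thesis using k by (simp add: W_def \<kappa>_def)
qed

lemma intrinsic_volume_compact:
  fixes K :: "'a::euclidean_space set"
  assumes "compact K"
  shows "intrinsic_volume K k = (THE V. steiner_coeffs K V) k"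
  using compact_imp_bounded[OF assms] by (simp add: intrinsic_volume_def)

lemma intrinsic_volume_compact_pos:
  fixes K :: "'a::euclidean_space set"
  assumes K: "compact K" "convex K" "K \<noteq> {}" and k: "int k \<le> aff_dim K"
  shows "intrinsic_volume K k > 0"
proof -
  have kd: "k \<le> DIM('a)" using k aff_dim_le_DIM[of K] by simp
  show ?thesis
    using compact_convex_steiner_polynomial[OF K]
  proof cases
    case (1 c)
    then show ?thesis
      using The_steiner_coeffs[OF K(1) 1(1,2) kd] 1(3)[OF k]
      by (simp add: intrinsic_volume_compact[OF K(1)])
  qed
qed

lemma intrinsic_volume_compact_finite:
  fixes K :: "'a::euclidean_space set"
  assumes K: "compact K" "convex K" "K \<noteq> {}" and kd: "k \<le> DIM('a)"
  shows "intrinsic_volume K k < \<infinity>"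
  using compact_convex_steiner_polynomial[OF K]
proof cases
  case (1 c)
  then show ?thesis
    using The_steiner_coeffs[OF K(1) 1(1,2) kd] by (simp add: intrinsic_volume_compact[OF K(1)])
qed

lemma closed_nbhd_affine:
  fixes S :: "'a::euclidean_space set"
  assumes l: "l > 0"
  shows "closed_nbhd ((\<lambda>x. l *\<^sub>R x + a) ` S) t = (\<lambda>x. l *\<^sub>R x + a) ` closed_nbhd S (t / l)"
proof (intro equalityI subsetI)
  fix y assume "y \<in> closed_nbhd ((\<lambda>x. l *\<^sub>R x + a) ` S) t"
  then obtain z v where "z \<in> S" "norm v \<le> t" "y = l *\<^sub>R z + a + v" by (auto simp: closed_nbhd_def)
  then have "y = l *\<^sub>R (z + v /\<^sub>R l) + a" "z \<in> S" "norm (v /\<^sub>R l) \<le> t / l"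
    using l by (auto simp: scaleR_add_right divide_simps)
  then show "y \<in> (\<lambda>x. l *\<^sub>R x + a) ` closed_nbhd S (t / l)"
    unfolding closed_nbhd_def by blast
next
  fix y assume "y \<in> (\<lambda>x. l *\<^sub>R x + a) ` closed_nbhd S (t / l)"
  then obtain z v where "z \<in> S" "norm v \<le> t / l" "y = l *\<^sub>R (z + v) + a" by (auto simp: closed_nbhd_def)
  then have "y = (l *\<^sub>R z + a) + l *\<^sub>R v" "z \<in> S" "norm (l *\<^sub>R v) \<le> t"
    using l by (auto simp: scaleR_add_right field_simps)
  then show "y \<in> closed_nbhd ((\<lambda>x. l *\<^sub>R x + a) ` S) t"
    unfolding closed_nbhd_def by blast
qed

text \<open>Scaling reduces to a unit segment, to which the polytope bound applies with constants
  that do not depend on its direction. Linear growth in the length will make the first intrinsic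
  volume of an unbounded set infinite.\<close>

lemma intrinsic_volume_segment_lower_bound:
  obtains \<delta> :: real where "\<delta> > 0"
    "\<And>a b :: 'a::euclidean_space. a \<noteq> b \<Longrightarrow> ennreal (\<delta> * dist a b) \<le> intrinsic_volume (closed_segment a b) 1"
proof
  let ?d = "DIM('a)"
  \<comment> \<open>The constants come from the bound with \<open>r = 1/4\<close> and
    \<open>R = 1\<close>: a unit segment extends by \<open>2 * r = 1/2\<close> on either side of its
    midpoint, and \<open>1 + R / r = 5\<close>.\<close>
  let ?\<mu> = "measure lebesgue (ball (0::'a) (1/4))"
  let ?C = "2 ^ ?d * 5 ^ (?d - 1) :: real"
  let ?\<delta> = "?\<mu> / ?C / unit_ball_vol (real (?d - 1))"
  have "?\<mu> > 0"
    using content_ball_pos[of "1/4" "0::'a"] by (simp add: measure_completion)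
  then show "?\<delta> > 0" by simp
  fix a b :: 'a assume ab: "a \<noteq> b"
  define l where "l = dist a b"
  have l: "l > 0" using ab by (simp add: l_def)
  define u where "u = (b - a) /\<^sub>R l"
  have u: "norm u = 1" using l by (simp add: u_def l_def dist_norm norm_minus_commute)
  let ?S = "closed_segment 0 u"
  have P: "polytope ?S" "?S \<noteq> {}" by (auto simp: segment_convex_hull intro!: polytope_convex_hull)
  have S: "?S = (\<lambda>s. s *\<^sub>R u) ` {0..1}" by (auto simp: closed_segment_def)
  have img: "closed_segment a b = (\<lambda>x. l *\<^sub>R x + a) ` ?S"
  proof -
    have b: "b = l *\<^sub>R u + a" using l by (simp add: u_def)
    have "(1 - s) *\<^sub>R a + s *\<^sub>R b = l *\<^sub>R (s *\<^sub>R u) + a" for s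
      by (simp add: b algebra_simps)
    then show ?thesis unfolding S by (simp only: closed_segment_image_interval image_image)
  qed
  define c where "c k = steiner_poly_coeff ?S k" for k
  have "?\<mu> \<le> 2 ^ ?d * (1 + 1 / (1/4)) ^ (?d - dim (span {u})) * steiner_poly_coeff ?S (dim (span {u}))"
  proof -
    have "(1/2) *\<^sub>R u + e \<in> ?S" if e: "e \<in> span {u}" "norm e \<le> 2 * (1/4)" for e
    proof -
      obtain s where s: "e = s *\<^sub>R u" using e by (auto simp: span_singleton)
      then have "\<bar>s\<bar> \<le> 1/2" using e u by simp
      then have "(1/2) *\<^sub>R u + e = (1 - (1/2 + s)) *\<^sub>R 0 + (1/2 + s) *\<^sub>R u" "0 \<le> 1/2 + s" "1/2 + s \<le> 1"
        using s by (auto simp: scaleR_add_left)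
      then show ?thesis unfolding closed_segment_def by blast
    qed
    moreover have "dist x y \<le> 1" if xy: "x \<in> ?S" "y \<in> ?S" for x y
    proof -
      obtain s s' where s: "x = s *\<^sub>R u" "y = s' *\<^sub>R u" "s \<in> {0..1}" "s' \<in> {0..1}"
        using xy unfolding S by blast
      then have "dist x y = \<bar>s - s'\<bar>"
        using u by (simp add: dist_norm scaleR_left_diff_distrib[symmetric])
      then show ?thesis using s by auto
    qed
    ultimately show ?thesis
      using steiner_poly_coeff_lower_bound[OF P(1) subspace_span[of "{u}"], of "1/4" "(1/2) *\<^sub>R u" 1] by simp
  qed
  then have c1: "?\<mu> / ?C \<le> c 1"
    using u by (simp add: c_def dim_singleton field_simps split: if_splits)
  \<comment> \<open>Of the factor \<open>l ^ ?d\<close> from scaling space,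
    \<open>l ^ (?d - k)\<close> is absorbed by replacing \<open>t\<close> with \<open>t / l\<close>.
    So the coefficient of index \<open>k\<close> is homogeneous of degree \<open>k\<close>.\<close>
  have "measure lebesgue (closed_nbhd (closed_segment a b) t) = (\<Sum>k\<le>?d. (l ^ k * c k) * t ^ (?d - k))"
    if t: "t > 0" for t
  proof -
    have "measure lebesgue (closed_nbhd (closed_segment a b) t) = l ^ ?d * measure lebesgue (closed_nbhd ?S (t / l))"
      unfolding img closed_nbhd_affine[OF l]
      using measure_lebesgue_affine[of l a "closed_nbhd ?S (t / l)"] l by simp
    also have "\<dots> = l ^ ?d * (\<Sum>k\<le>?d. c k * (t / l) ^ (?d - k))"
      using measure_closed_nbhd_polytope[OF P, of "t / l"] t l by (simp add: c_def)
    also have "\<dots> = (\<Sum>k\<le>?d. (l ^ k * c k) * t ^ (?d - k))"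
      unfolding sum_distrib_left
    proof (rule sum.cong)
      fix k assume "k \<in> {..?d}"
      then have "l ^ ?d = l ^ k * l ^ (?d - k)" by (simp add: power_add[symmetric])
      then show "l ^ ?d * (c k * (t / l) ^ (?d - k)) = l ^ k * c k * t ^ (?d - k)"
        using l by (simp add: power_divide)
    qed simp
    finally show ?thesis .
  qed
  moreover have "0 \<le> l ^ k * c k" for k using l by (simp add: c_def steiner_poly_coeff_nonneg)
  moreover have "1 \<le> ?d" by (simp add: Suc_leI)
  ultimately have "intrinsic_volume (closed_segment a b) 1 = ennreal (l ^ 1 * c 1 / unit_ball_vol (real (?d - 1)))"
    using The_steiner_coeffs[of "closed_segment a b" "\<lambda>k. l ^ k * c k" 1] by (simp add: intrinsic_volume_compact)
  moreover have "?\<delta> * l \<le> l ^ 1 * c 1 / unit_ball_vol (real (?d - 1))"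
  proof -
    have "?\<delta> * l \<le> c 1 / unit_ball_vol (real (?d - 1)) * l"
      using l c1 by (intro mult_right_mono divide_right_mono) auto
    then show ?thesis by (simp add: mult.commute)
  qed
  ultimately show "ennreal (?\<delta> * dist a b) \<le> intrinsic_volume (closed_segment a b) 1"
    by (simp only: l_def[symmetric] ennreal_leI)
qed

subsection \<open>The normalizing constant\<close>

text \<open>The substitution \<open>u = t^2 / \<sigma>\<close> turns the Gamma integral at
  \<open>j / 2\<close> into this one up to a constant; the factor \<open>j / 2\<close> is absorbed
  by \<open>Gamma (a + 1) = a * Gamma a\<close>.\<close>

lemma nn_integral_power_gauss:
  fixes j :: nat and \<sigma> :: real
  assumes j: "j \<ge> 1" and \<sigma>: "\<sigma> > 0"
  shows "(\<integral>\<^sup>+t\<in>{0<..}. ennreal (exp (- t\<^sup>2 / \<sigma>) * (real j * t ^ (j - 1))) \<partial>lborel)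
       = ennreal (\<sigma> powr (real j / 2) * Gamma (real j / 2 + 1))"
proof -
  let ?S = "{0<..} :: real set" and ?a = "real j / 2"
  define f where "f u = u powr (?a - 1) / exp u" for u :: real
  define g where "g t = t\<^sup>2 / \<sigma>" for t :: real
  have a: "?a > 0" using j by simp
  have "(f has_integral Gamma ?a) {0..}"
    unfolding f_def by (rule Gamma_integral_real[OF a])
  then have f: "(f has_integral Gamma ?a) ?S"
    by (rule has_integral_spike_set_eq[THEN iffD1, rotated 2]) (auto intro: negligible_subset[of "{0}"])
  have f_abs: "f absolutely_integrable_on ?S" "integral ?S f = Gamma ?a"
    using f by (auto intro!: nonnegative_absolutely_integrable_1 simp: f_def integral_unique)
  have gS: "g ` ?S = ?S"
  proof (intro equalityI subsetI)
    fix u :: real assume u: "u \<in> ?S"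
    then have "g (sqrt (\<sigma> * u)) = u" using \<sigma> by (simp add: g_def)
    moreover have "sqrt (\<sigma> * u) \<in> ?S" using u \<sigma> by simp
    ultimately show "u \<in> g ` ?S" by (metis imageI)
  qed (use \<sigma> in \<open>auto simp: g_def\<close>)
  have inj: "inj_on g ?S" using less_imp_neq[OF \<sigma>] by (auto simp: g_def inj_on_def)
  have der: "(g has_field_derivative (2 * t / \<sigma>)) (at t within ?S)" for t
    unfolding g_def using \<sigma> by (auto intro!: derivative_eq_intros)
  have cv: "(\<lambda>t. \<bar>2 * t / \<sigma>\<bar> * f (g t)) absolutely_integrable_on ?S \<and>
      integral ?S (\<lambda>t. \<bar>2 * t / \<sigma>\<bar> * f (g t)) = Gamma ?a"
    using has_absolute_integral_change_of_variables_1'[of ?S g "\<lambda>t. 2 * t / \<sigma>" f "Gamma ?a"] der inj f_abs gS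
    by simp
  then have "((\<lambda>t. \<bar>2 * t / \<sigma>\<bar> * f (g t)) has_integral Gamma ?a) ?S"
    using set_lebesgue_integral_eq_integral(1) has_integral_integral by (metis absolutely_integrable_on_def)
  from has_integral_mult_right[OF this, of "?a * \<sigma> powr ?a"]
  have "((\<lambda>t. ?a * \<sigma> powr ?a * (\<bar>2 * t / \<sigma>\<bar> * f (g t))) has_integral ?a * \<sigma> powr ?a * Gamma ?a) ?S"
    by simp
  then have int: "((\<lambda>t. exp (- t\<^sup>2 / \<sigma>) * (real j * t ^ (j - 1))) has_integral ?a * \<sigma> powr ?a * Gamma ?a) ?S"
  proof (rule has_integral_eq[rotated])
    fix t :: real assume "t \<in> ?S"
    then have t: "t > 0" by simp
    have e1: "g t powr (?a - 1) = t powr (real j - 2) * \<sigma> powr (1 - ?a)"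
    proof -
      have t2: "t\<^sup>2 = t powr 2" using t by simp
      have "g t powr (?a - 1) = (t powr 2) powr (?a - 1) / \<sigma> powr (?a - 1)"
        unfolding g_def t2 by (rule powr_divide)
      also have "(t powr 2) powr (?a - 1) = t powr (real j - 2)"
        unfolding powr_powr by (rule arg_cong[where f = "\<lambda>b. t powr b"]) simp
      also have "\<dots> / \<sigma> powr (?a - 1) = t powr (real j - 2) * \<sigma> powr (1 - ?a)"
        using powr_minus_divide[of \<sigma> "?a - 1"] by simp
      finally show ?thesis .
    qed
    have e2: "t * t powr (real j - 2) = t ^ (j - 1)"
    proof -
      have "t * t powr (real j - 2) = t powr (real (j - 1))"
        using t j by (simp add: powr_mult_base of_nat_diff)
      then show ?thesis using t by (simp add: powr_realpow)
    qed
    have e3: "\<sigma> powr ?a * \<sigma> powr (1 - ?a) = \<sigma>" using \<sigma> by (simp add: powr_add[symmetric])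
    have "g t powr (?a - 1) * t * \<sigma> powr ?a = (t * t powr (real j - 2)) * (\<sigma> powr ?a * \<sigma> powr (1 - ?a))"
      unfolding e1 by (simp only: mult_ac)
    then have *: "g t powr (?a - 1) * t * \<sigma> powr ?a = t ^ (j - 1) * \<sigma>"
      unfolding e2 e3 .
    have "?a * \<sigma> powr ?a * (\<bar>2 * t / \<sigma>\<bar> * f (g t)) = real j / \<sigma> / exp (g t) * (g t powr (?a - 1) * t * \<sigma> powr ?a)"
      using t \<sigma> by (simp add: f_def field_simps)
    also have "\<dots> = exp (- t\<^sup>2 / \<sigma>) * (real j * t ^ (j - 1))"
      unfolding * using \<sigma> by (simp add: g_def exp_minus field_simps)
    finally show "?a * \<sigma> powr ?a * (\<bar>2 * t / \<sigma>\<bar> * f (g t)) = exp (- t\<^sup>2 / \<sigma>) * (real j * t ^ (j - 1))" .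
  qed
  \<comment> \<open>Truncation changes nothing on \<open>?S\<close> but makes the integrand
    nonnegative on the whole line.\<close>
  have "((\<lambda>t. max 0 (exp (- t\<^sup>2 / \<sigma>) * (real j * t ^ (j - 1)))) has_integral ?a * \<sigma> powr ?a * Gamma ?a) ?S"
    by (rule has_integral_eq[OF _ int]) auto
  from nn_integral_has_integral_lebesgue[OF _ this]
  have n1: "(\<integral>\<^sup>+t. ennreal (indicator ?S t * max 0 (exp (- t\<^sup>2 / \<sigma>) * (real j * t ^ (j - 1)))) \<partial>lborel)
      = ennreal (?a * \<sigma> powr ?a * Gamma ?a)" by simp
  have n2: "(\<integral>\<^sup>+t\<in>?S. ennreal (exp (- t\<^sup>2 / \<sigma>) * (real j * t ^ (j - 1))) \<partial>lborel)
     = (\<integral>\<^sup>+t. ennreal (indicator ?S t * max 0 (exp (- t\<^sup>2 / \<sigma>) * (real j * t ^ (j - 1)))) \<partial>lborel)"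
    by (intro nn_integral_cong) (auto simp: indicator_def)
  have n3: "?a * \<sigma> powr ?a * Gamma ?a = \<sigma> powr ?a * Gamma (?a + 1)"
    using a by (subst Gamma_plus1) (auto dest: nonpos_Ints_nonpos)
  show ?thesis unfolding n2 n1 n3 ..
qed

text \<open>The Steiner polynomial is differentiated and integrated term by term. The value
  \<open>Gamma (x + 1)\<close> from the Gaussian integral cancels the one in the unit ball volume,
  which leaves the power of \<open>pi\<close>.\<close>

lemma normalizing_const_bounded:
  fixes Z :: "'a::euclidean_space set"
  assumes Z: "compact Z" "convex Z" "Z \<noteq> {}" and \<sigma>: "\<sigma> > 0"
  shows "normalizing_const Z \<sigma> =
    (\<Sum>k<DIM('a). ennreal (pi powr (real (DIM('a) - k) / 2)) * intrinsic_volume Z k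
                  * ennreal (\<sigma> powr (real (DIM('a) - k) / 2)))"
  using compact_convex_steiner_polynomial[OF Z]
proof cases
  case (1 c)
  let ?d = "DIM('a)"
  have area: "level_set_area Z t = ennreal (\<Sum>k<?d. c k * (real (?d - k) * t ^ (?d - k - 1)))"
    if t: "t > 0" for t
  proof -
    have D: "((\<lambda>s. \<Sum>k\<le>?d. c k * s ^ (?d - k)) has_field_derivative
        (\<Sum>k\<le>?d. c k * (real (?d - k) * t ^ (?d - k - 1)))) (at t)"
      by (auto intro!: derivative_eq_intros sum.cong simp: ac_simps)
    have ev: "eventually (\<lambda>s. measure lborel (closed_nbhd Z s) = (\<Sum>k\<le>?d. c k * s ^ (?d - k))) (nhds t)"
      using eventually_nhds_in_open[of "{0<..}" t] t
      by (auto elim!: eventually_mono simp: emeasure_closed_nbhd(2)[OF Z(1)] 1(2))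
    have "((\<lambda>s. measure lborel (closed_nbhd Z s)) has_field_derivative
        (\<Sum>k\<le>?d. c k * (real (?d - k) * t ^ (?d - k - 1)))) (at t)"
      by (rule DERIV_cong_ev[OF refl ev refl, THEN iffD2, OF D])
    \<comment> \<open>The term \<open>k = ?d\<close>, the volume of \<open>Z\<close> itself, is
      constant in \<open>t\<close> and drops out; hence the final sum stops at
      \<open>?d - 1\<close>.\<close>
    moreover have "(\<Sum>k\<le>?d. c k * (real (?d - k) * t ^ (?d - k - 1))) = (\<Sum>k<?d. c k * (real (?d - k) * t ^ (?d - k - 1)))"
      by (simp add: lessThan_Suc_atMost[symmetric])
    ultimately show ?thesis
      using compact_imp_bounded[OF Z(1)] by (simp add: level_set_area_def DERIV_imp_deriv)
  qed
  have "normalizing_const Z \<sigma> = (\<integral>\<^sup>+t. (\<Sum>k<?d. ennreal (c k) *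
      (ennreal (exp (- t\<^sup>2 / \<sigma>) * (real (?d - k) * t ^ (?d - k - 1))) * indicator {0<..} t)) \<partial>lborel)"
    unfolding normalizing_const_def
  proof (rule nn_integral_cong)
    fix t :: real
    show "ennreal (exp (- t\<^sup>2 / \<sigma>)) * level_set_area Z t * indicator {0<..} t = (\<Sum>k<?d. ennreal (c k) *
      (ennreal (exp (- t\<^sup>2 / \<sigma>) * (real (?d - k) * t ^ (?d - k - 1))) * indicator {0<..} t))"
    proof (cases "t > 0")
      case True
      have "ennreal (exp (- t\<^sup>2 / \<sigma>)) * level_set_area Z t
          = ennreal (exp (- t\<^sup>2 / \<sigma>) * (\<Sum>k<?d. c k * (real (?d - k) * t ^ (?d - k - 1))))"
        unfolding area[OF True] using True 1(1) by (intro ennreal_mult[symmetric] sum_nonneg) auto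
      also have "\<dots> = ennreal (\<Sum>k<?d. c k * (exp (- t\<^sup>2 / \<sigma>) * (real (?d - k) * t ^ (?d - k - 1))))"
        by (simp add: sum_distrib_left mult_ac)
      also have "\<dots> = (\<Sum>k<?d. ennreal (c k * (exp (- t\<^sup>2 / \<sigma>) * (real (?d - k) * t ^ (?d - k - 1)))))"
        using True 1(1) by (intro sum_ennreal[symmetric]) auto
      also have "\<dots> = (\<Sum>k<?d. ennreal (c k) * ennreal (exp (- t\<^sup>2 / \<sigma>) * (real (?d - k) * t ^ (?d - k - 1))))"
        using True 1(1) by (intro sum.cong ennreal_mult) auto
      finally show ?thesis using True by simp
    qed simp
  qed
  also have "\<dots> = (\<Sum>k<?d. ennreal (c k) *
      (\<integral>\<^sup>+t\<in>{0<..}. ennreal (exp (- t\<^sup>2 / \<sigma>) * (real (?d - k) * t ^ (?d - k - 1))) \<partial>lborel))"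
    by (subst nn_integral_sum) (auto intro!: sum.cong nn_integral_cmult)
  also have "\<dots> = (\<Sum>k<?d. ennreal (pi powr (real (?d - k) / 2)) * intrinsic_volume Z k
                  * ennreal (\<sigma> powr (real (?d - k) / 2)))"
  proof (intro sum.cong refl)
    fix k assume "k \<in> {..<?d}"
    then have k: "k \<le> ?d" "?d - k \<ge> 1" by auto
    let ?x = "real (?d - k) / 2"
    have \<kappa>: "unit_ball_vol (real (?d - k)) = pi powr ?x / Gamma (?x + 1)" "unit_ball_vol (real (?d - k)) > 0"
      by (simp only: unit_ball_vol_def) simp
    have \<Gamma>: "Gamma (?x + 1) > 0" by (intro Gamma_real_pos) (simp add: add_nonneg_pos)
    have V: "intrinsic_volume Z k = ennreal (c k / unit_ball_vol (real (?d - k)))"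
      using The_steiner_coeffs[OF Z(1) 1(1,2) k(1)] by (simp add: intrinsic_volume_compact[OF Z(1)])
    have "ennreal (pi powr ?x) * intrinsic_volume Z k * ennreal (\<sigma> powr ?x)
        = ennreal (pi powr ?x * (c k / unit_ball_vol (real (?d - k))) * \<sigma> powr ?x)"
      unfolding V using 1(1)[OF k(1)] less_imp_le[OF \<kappa>(2)] by (simp only: ennreal_mult[symmetric] powr_ge_zero mult_nonneg_nonneg divide_nonneg_nonneg)
    also have "pi powr ?x * (c k / unit_ball_vol (real (?d - k))) * \<sigma> powr ?x = c k * (\<sigma> powr ?x * Gamma (?x + 1))"
      unfolding \<kappa>(1) using \<Gamma> by (simp add: field_simps)
    also have "ennreal \<dots> = ennreal (c k) * ennreal (\<sigma> powr ?x * Gamma (?x + 1))"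
      using 1(1)[OF k(1)] \<Gamma> by (intro ennreal_mult) auto
    finally show "ennreal (c k) *
      (\<integral>\<^sup>+t\<in>{0<..}. ennreal (exp (- t\<^sup>2 / \<sigma>) * (real (?d - k) * t ^ (?d - k - 1))) \<partial>lborel)
      = ennreal (pi powr ?x) * intrinsic_volume Z k * ennreal (\<sigma> powr ?x)"
      unfolding nn_integral_power_gauss[OF k(2) \<sigma>] by simp
  qed
  finally show ?thesis .
qed

section \<open>Passage to unbounded closed convex sets\<close>

lemma exists_affine_spanning_compact_subset:
  fixes Z :: "'a::euclidean_space set"
  assumes "convex Z" "Z \<noteq> {}"
  obtains K where "compact K" "convex K" "K \<noteq> {}" "K \<subseteq> Z" "aff_dim K = aff_dim Z"
proof -
  obtain S where S: "S \<subseteq> Z" "finite S" "affine hull Z = affine hull S"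
    using affine_basis_exists[of Z] aff_independent_finite by metis
  show ?thesis
  proof
    show "compact (convex hull S)" "convex (convex hull S)" using S by (simp_all add: finite_imp_compact_convex_hull)
    show "convex hull S \<noteq> {}" using S assms by (metis affine_hull_eq_empty convex_hull_eq_empty)
    show "convex hull S \<subseteq> Z" using S assms by (intro hull_minimal) auto
    show "aff_dim (convex hull S) = aff_dim Z"
      using S(3) by (metis aff_dim_affine_hull aff_dim_convex_hull)
  qed
qed

text \<open>In the unbounded case the supremum dominates its value at one compact convex subset of
  full affine dimension in \<open>Z\<close>.\<close>

lemma intrinsic_volume_pos:
  fixes Z :: "'a::euclidean_space set"
  assumes Z: "closed Z" "convex Z" "Z \<noteq> {}" and k: "int k \<le> aff_dim Z"
  shows "intrinsic_volume Z k > 0"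
proof (cases "bounded Z")
  case True
  then show ?thesis using Z k by (intro intrinsic_volume_compact_pos) (auto simp: compact_eq_bounded_closed)
next
  case False
  obtain K where K: "compact K" "convex K" "K \<noteq> {}" "K \<subseteq> Z" "aff_dim K = aff_dim Z"
    using exists_affine_spanning_compact_subset[OF Z(2,3)] .
  have "0 < intrinsic_volume K k" using K k by (intro intrinsic_volume_compact_pos) auto
  also have "\<dots> \<le> intrinsic_volume Z k"
    unfolding intrinsic_volume_compact[OF K(1)] intrinsic_volume_def[of Z] using False K
    by (auto intro!: SUP_upper)
  finally show ?thesis .
qed

text \<open>By convexity \<open>Z\<close> contains segments of every length, which compete in the
  supremum.\<close>

lemma intrinsic_volume_1_unbounded:
  fixes Z :: "'a::euclidean_space set"
  assumes Z: "convex Z" "\<not> bounded Z"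
  shows "intrinsic_volume Z 1 = \<infinity>"
proof -
  obtain \<delta> :: real where \<delta>: "\<delta> > 0"
    "\<And>a b :: 'a. a \<noteq> b \<Longrightarrow> ennreal (\<delta> * dist a b) \<le> intrinsic_volume (closed_segment a b) 1"
    by (rule intrinsic_volume_segment_lower_bound) blast
  have "Z \<noteq> {}" using Z by auto
  then obtain a where a: "a \<in> Z" by blast
  have le: "ennreal x \<le> intrinsic_volume Z 1" if x: "x \<ge> 0" for x
  proof -
    \<comment> \<open>The extra 1 keeps \<open>b\<close> distinct from \<open>a\<close> even if
      \<open>x = 0\<close>.\<close>
    have "\<not> (\<forall>y\<in>Z. dist a y \<le> x / \<delta> + 1)" using Z(2) bounded_def by blast
    then obtain b where b: "b \<in> Z" "dist a b > x / \<delta> + 1" by force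
    have "x / \<delta> \<ge> 0" using x \<delta> by simp
    then have ab: "a \<noteq> b" "x / \<delta> \<le> dist a b" using b by auto
    then have "ennreal x \<le> ennreal (\<delta> * dist a b)"
      using \<delta> by (intro ennreal_leI) (simp add: field_simps)
    also have "\<dots> \<le> intrinsic_volume (closed_segment a b) 1" using \<delta>(2)[OF ab(1)] .
    also have "\<dots> \<le> intrinsic_volume Z 1"
      unfolding intrinsic_volume_compact[OF compact_segment] intrinsic_volume_def[of Z]
      using Z a b closed_segment_subset[OF a b(1) Z(1)] by (auto intro!: SUP_upper)
    finally show ?thesis .
  qed
  show ?thesis
  proof (cases "intrinsic_volume Z 1")
    case (real v)
    then show ?thesis using le[of "v + 1"] by (simp add: ennreal_le_iff)
  qed simp
qed

text \<open>Centres at mutual distance at least \<open>2 * r\<close> are chosen greedily, since an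
  unbounded set has points far from any finite set. Then \<open>A\<close> contains any number of
  disjoint balls of one volume.\<close>

lemma emeasure_lborel_infinite_of_separated_balls:
  fixes L A :: "'a::euclidean_space set"
  assumes L: "\<not> bounded L" and r: "r > 0" and A: "A \<in> sets borel"
    and balls: "\<And>x. x \<in> L \<Longrightarrow> ball x r \<subseteq> A"
  shows "emeasure lborel A = \<infinity>"
proof (rule ccontr)
  assume fin: "emeasure lborel A \<noteq> \<infinity>"
  have far: "\<exists>x\<in>L. \<forall>y\<in>F. dist x y \<ge> 2 * r" if finF: "finite F" for F :: "'a set"
  proof -
    obtain B where B: "\<And>y. y \<in> F \<Longrightarrow> norm y \<le> B"
      using finite_imp_bounded[OF finF] by (auto simp: bounded_iff)
    obtain x where x: "x \<in> L" "norm x > B + 2 * r" using L unfolding bounded_iff by (meson not_le_imp_less)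
    have "dist x y \<ge> 2 * r" if "y \<in> F" for y
      using B[OF that] x(2) norm_triangle_ineq2[of x y] by (simp add: dist_norm)
    then show ?thesis using x by blast
  qed
  have "\<exists>F. finite F \<and> card F = n \<and> F \<subseteq> L \<and> (\<forall>x\<in>F. \<forall>y\<in>F. x \<noteq> y \<longrightarrow> dist x y \<ge> 2 * r)" for n
  proof (induction n)
    case (Suc n)
    then obtain F where F: "finite F" "card F = n" "F \<subseteq> L" "\<forall>x\<in>F. \<forall>y\<in>F. x \<noteq> y \<longrightarrow> dist x y \<ge> 2 * r"
      by blast
    obtain x where x: "x \<in> L" "\<forall>y\<in>F. dist x y \<ge> 2 * r" using far[OF F(1)] by blast
    have "x \<notin> F" using x(2) r by force
    then show ?case using F x by (intro exI[of _ "insert x F"]) (auto simp: dist_commute)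
  qed (auto intro: exI[of _ "{}"])
  then obtain F where F: "\<And>n. finite (F n)" "\<And>n. card (F n) = n" "\<And>n. F n \<subseteq> L"
    "\<And>n x y. x \<in> F n \<Longrightarrow> y \<in> F n \<Longrightarrow> x \<noteq> y \<Longrightarrow> dist x y \<ge> 2 * r" by metis
  define v where "v = measure lborel (ball (0::'a) r)"
  have v: "v > 0" unfolding v_def by (rule content_ball_pos[OF r])
  have mv: "measure lborel (ball x r) = v" for x :: 'a
    using content_ball_conv_unit_ball[of r x] content_ball_conv_unit_ball[of r "0::'a"] r by (simp add: v_def)
  have "real n * v \<le> measure lborel A" for n
  proof -
    have disj: "disjoint_family_on (\<lambda>x. ball x r) (F n)"
      unfolding disjoint_family_on_def
    proof (intro ballI impI)
      fix x y assume xy: "x \<in> F n" "y \<in> F n" "x \<noteq> y"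
      have "z \<notin> ball y r" if "z \<in> ball x r" for z
        using F(4)[OF xy] that dist_triangle[of x y z] by (simp add: dist_commute)
      then show "ball x r \<inter> ball y r = {}" by blast
    qed
    have "real n * v = (\<Sum>x\<in>F n. measure lborel (ball x r))" using F(2) by (simp add: mv)
    also have "\<dots> = measure lborel (\<Union>x\<in>F n. ball x r)"
      using F(1) disj r by (intro measure_finite_Union[symmetric]) (auto simp: emeasure_ball)
    also have "\<dots> \<le> measure lborel A"
      using F(3) balls A fin
      by (intro measure_mono_fmeasurable) (auto simp: fmeasurable_def less_top intro!: borel_open open_UN)
    finally show ?thesis .
  qed
  moreover obtain n where "real n * v > measure lborel A" using reals_Archimedean3[OF v] by blast
  ultimately show False using linorder_not_le by blast
qed

text \<open>A hyperplane separates \<open>Z\<close> from a point outside; moving from that point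
  along the normal, away from \<open>Z\<close>, makes the distance as large as desired.\<close>

lemma infdist_unbounded:
  fixes Z :: "'a::euclidean_space set"
  assumes Z: "closed Z" "convex Z" "Z \<noteq> UNIV" "Z \<noteq> {}"
  shows "\<exists>y. infdist y Z > c"
proof -
  obtain z where z: "z \<notin> Z" using Z by auto
  obtain a b where ab: "a \<bullet> z < b" "\<And>x. x \<in> Z \<Longrightarrow> b < a \<bullet> x"
    using separating_hyperplane_closed_point[OF Z(2,1) z] by auto
  have a: "a \<noteq> 0" using ab Z(4) by auto
  define y where "y = z - ((\<bar>c\<bar> + 1) / norm a) *\<^sub>R a"
  obtain w where w: "w \<in> Z" "infdist y Z = dist y w" using infdist_attains_inf[OF Z(1,4)] by blast
  have "a \<bullet> y = a \<bullet> z - (\<bar>c\<bar> + 1) * norm a"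
    using a by (simp add: y_def inner_diff_right power2_norm_eq_inner[symmetric] power2_eq_square)
  then have "(\<bar>c\<bar> + 1) * norm a \<le> a \<bullet> (w - y)" using ab w(1) by (force simp: inner_diff_right)
  also have "\<dots> \<le> norm a * norm (w - y)" by (rule norm_cauchy_schwarz)
  finally have "(\<bar>c\<bar> + 1) \<le> norm (w - y)" using a by (simp add: mult.commute)
  then have "infdist y Z > c" using w(2) by (simp add: dist_norm norm_minus_commute)
  then show ?thesis by blast
qed

text \<open>If the level set were inside a ball, the connected complement of that ball would lie on
  one side of the level. Far points of \<open>Z\<close> force the near side, so the distance would
  be bounded on the whole space.\<close>

lemma level_set_unbounded:
  fixes Z :: "'a::euclidean_space set"
  assumes Z: "closed Z" "convex Z" "Z \<noteq> UNIV" "\<not> bounded Z" and d: "DIM('a) \<ge> 2" and c: "c > 0"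
  shows "\<not> bounded {y. infdist y Z = c}"
proof
  assume "bounded {y. infdist y Z = c}"
  then obtain R where R: "\<And>y. infdist y Z = c \<Longrightarrow> norm y \<le> R" by (auto simp: bounded_iff)
  have ne: "Z \<noteq> {}" using Z by auto
  let ?U = "- cball (0::'a) R"
  have U: "connected ?U" using d by (intro connected_complement_bounded_convex) auto
  have op: "open {y. infdist y Z < c}" "open {y. infdist y Z > c}"
    by (intro open_Collect_less continuous_intros)+
  have "?U \<subseteq> {y. infdist y Z < c} \<union> {y. infdist y Z > c}" using R by force
  then have "{y. infdist y Z < c} \<inter> ?U = {} \<or> {y. infdist y Z > c} \<inter> ?U = {}"
    by (intro connectedD[OF U op]) auto
  moreover obtain z where z: "z \<in> Z" "norm z > R"
    using Z(4) unfolding bounded_iff by (meson not_le_imp_less)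
  then have "z \<in> {y. infdist y Z < c} \<inter> ?U" using c by simp
  ultimately have dis: "{y. infdist y Z > c} \<inter> ?U = {}" by auto
  have le: "infdist y Z \<le> c" if "norm y > R" for y
  proof (rule ccontr)
    assume "\<not> infdist y Z \<le> c"
    then have "y \<in> {y. infdist y Z > c} \<inter> ?U" using that by simp
    then show False using dis by blast
  qed
  \<comment> \<open>Such a \<open>y\<close> lies in the ball, hence within
    \<open>2 * \<bar>R\<bar> + 1\<close> of the point \<open>b\<close> just outside, whose distance
    to \<open>Z\<close> is at most \<open>c\<close>.\<close>
  obtain y where y: "infdist y Z > c + 2 * \<bar>R\<bar> + 2" using infdist_unbounded[OF Z(1-3) ne] by blast
  have "norm y \<le> R" using le[of y] y by force
  moreover obtain b :: 'a where b: "norm b = \<bar>R\<bar> + 1" using vector_choose_size[of "\<bar>R\<bar> + 1"] by auto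
  then have "infdist b Z \<le> c" by (intro le) simp
  ultimately show False
    using infdist_triangle[of y Z b] y b norm_triangle_ineq4[of y b] by (simp add: dist_norm)
qed

text \<open>The distance function is 1-Lipschitz, so balls of half the shell's width around points
  of the middle level set stay inside the shell.\<close>

lemma shell_infinite:
  fixes Z :: "'a::euclidean_space set"
  assumes Z: "closed Z" "convex Z" "Z \<noteq> UNIV" "\<not> bounded Z" and d: "DIM('a) \<ge> 2" and st: "0 < s" "s < t"
  shows "emeasure lborel (closed_nbhd Z t - closed_nbhd Z s) = \<infinity>"
proof (rule emeasure_lborel_infinite_of_separated_balls)
  have ne: "Z \<noteq> {}" using Z by auto
  have N: "closed_nbhd Z u = {y. infdist y Z \<le> u}" for u by (rule closed_nbhd_eq_infdist[OF Z(1) ne])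
  show "\<not> bounded {y. infdist y Z = (s + t) / 2}"
    using st by (intro level_set_unbounded[OF Z d]) auto
  show "0 < (t - s) / 2" using st by simp
  have "closed {y. infdist y Z \<le> u}" for u by (intro closed_Collect_le continuous_intros)
  then show "closed_nbhd Z t - closed_nbhd Z s \<in> sets borel" unfolding N by auto
  fix x assume x: "x \<in> {y. infdist y Z = (s + t) / 2}"
  show "ball x ((t - s) / 2) \<subseteq> closed_nbhd Z t - closed_nbhd Z s"
  proof
    fix y assume "y \<in> ball x ((t - s) / 2)"
    then have "dist x y < (t - s) / 2" by simp
    then show "y \<in> closed_nbhd Z t - closed_nbhd Z s"
      using x infdist_triangle[of x Z y] infdist_triangle[of y Z x]
      by (simp add: N dist_commute field_simps)
  qed
qed

text \<open>The difference quotient is infinite for every positive \<open>s\<close> other than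
  \<open>t\<close>, so its limit is that of a constant.\<close>

lemma level_set_area_unbounded:
  fixes Z :: "'a::euclidean_space set"
  assumes Z: "closed Z" "convex Z" "Z \<noteq> UNIV" "\<not> bounded Z" and d: "DIM('a) \<ge> 2" and t: "0 < t"
  shows "level_set_area Z t = \<infinity>"
proof -
  have "eventually (\<lambda>s. s > 0 \<and> s \<noteq> t) (at t)"
    using t order_tendstoD(1)[OF tendsto_ident_at t] eventually_neq_at_within[of t t UNIV]
    by (intro eventually_conj) auto
  then have "eventually (\<lambda>s. emeasure lborel (closed_nbhd Z (max s t) - closed_nbhd Z (min s t))
                            / ennreal \<bar>s - t\<bar> = \<infinity>) (at t)"
  proof (rule eventually_mono)
    fix s assume s: "s > 0 \<and> s \<noteq> t"
    have "emeasure lborel (closed_nbhd Z (max s t) - closed_nbhd Z (min s t)) = \<infinity>"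
      using s t by (intro shell_infinite[OF Z d]) (auto simp: min_def max_def)
    then show "emeasure lborel (closed_nbhd Z (max s t) - closed_nbhd Z (min s t)) / ennreal \<bar>s - t\<bar> = \<infinity>"
      by (simp add: ennreal_top_divide)
  qed
  then have "((\<lambda>s. emeasure lborel (closed_nbhd Z (max s t) - closed_nbhd Z (min s t))
                            / ennreal \<bar>s - t\<bar>) \<longlongrightarrow> \<infinity>) (at t)"
    by (rule tendsto_eventually)
  then show ?thesis
    using Z(4) by (simp add: level_set_area_def tendsto_Lim trivial_limit_at)
qed

lemma normalizing_const_unbounded:
  fixes Z :: "'a::euclidean_space set"
  assumes Z: "closed Z" "convex Z" "Z \<noteq> UNIV" "\<not> bounded Z" and d: "DIM('a) \<ge> 2"
  shows "normalizing_const Z \<sigma> = \<infinity>"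
proof -
  have "normalizing_const Z \<sigma> = (\<integral>\<^sup>+t. \<infinity> * indicator {0::real<..} t \<partial>lborel)"
    unfolding normalizing_const_def
    by (intro nn_integral_cong) (auto simp: indicator_def level_set_area_unbounded[OF Z d] ennreal_mult_top)
  also have "\<dots> = \<infinity> * emeasure lborel {0::real<..}"
    by (rule nn_integral_cmult_indicator) simp
  also have "\<dots> = \<infinity>"
  proof -
    have "emeasure lborel {0<..<1::real} \<le> emeasure lborel {0::real<..}" by (intro emeasure_mono) auto
    then show ?thesis by (auto simp: ennreal_mult_eq_top_iff ennreal_top_mult)
  qed
  finally show ?thesis .
qed

text \<open>The provisos exclude cases where the identity fails. For \<open>Z = UNIV\<close> the
  shells are empty and the constant is 0, unlike the right-hand side; for a half-line in dimension
  one the constant is half the right-hand side. Positivity stops at the affine dimension: a point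
  has first intrinsic volume 0.\<close>

theorem theorem2:
  fixes Z :: "(real ^ 'n) set" and \<sigma> :: real
  assumes "closed Z" and "convex Z" and "Z \<noteq> {}" and "\<sigma> > 0"
  shows "(bounded Z \<or> (CARD('n) \<ge> 2 \<and> Z \<noteq> UNIV) \<longrightarrow>
           normalizing_const Z \<sigma> =
             (\<Sum>k<CARD('n). ennreal (pi powr (real (CARD('n) - k) / 2)) * intrinsic_volume Z k
                             * ennreal (\<sigma> powr (real (CARD('n) - k) / 2))))
       \<and> (\<forall>k<CARD('n). int k \<le> aff_dim Z \<longrightarrow> intrinsic_volume Z k > 0)
       \<and> (bounded Z \<and> interior Z \<noteq> {} \<longrightarrow>
           (\<forall>k<CARD('n). 0 < intrinsic_volume Z k \<and> intrinsic_volume Z k < \<infinity>))"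
proof (intro conjI impI allI)
  assume *: "bounded Z \<or> (CARD('n) \<ge> 2 \<and> Z \<noteq> UNIV)"
  show "normalizing_const Z \<sigma> =
             (\<Sum>k<CARD('n). ennreal (pi powr (real (CARD('n) - k) / 2)) * intrinsic_volume Z k
                             * ennreal (\<sigma> powr (real (CARD('n) - k) / 2)))"
  proof (cases "bounded Z")
    case True
    then show ?thesis
      using normalizing_const_bounded[of Z \<sigma>] assms by (simp add: compact_eq_bounded_closed)
  next
    case False
    with * have d: "CARD('n) \<ge> 2" "Z \<noteq> UNIV" by auto
    \<comment> \<open>The term \<open>k = 1\<close> alone is infinite, and it belongs to the sum
      because the dimension is at least 2.\<close>
    have "ennreal (pi powr (real (CARD('n) - 1) / 2)) * intrinsic_volume Z 1
        * ennreal (\<sigma> powr (real (CARD('n) - 1) / 2)) = \<infinity>"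
      using intrinsic_volume_1_unbounded[OF assms(2) False] assms(4)
      by (simp add: ennreal_mult_top ennreal_top_mult)
    moreover have "1 \<in> {..<CARD('n)}" using d by simp
    ultimately have "(\<Sum>k<CARD('n). ennreal (pi powr (real (CARD('n) - k) / 2)) * intrinsic_volume Z k
                             * ennreal (\<sigma> powr (real (CARD('n) - k) / 2))) = \<infinity>"
      unfolding infinity_ennreal_def ennreal_sum_eq_top[OF finite_lessThan] by blast
    moreover have "normalizing_const Z \<sigma> = \<infinity>"
      using assms False d by (intro normalizing_const_unbounded) auto
    ultimately show ?thesis by (simp only:)
  qed
next
  fix k assume "k < CARD('n)" "int k \<le> aff_dim Z"
  then show "intrinsic_volume Z k > 0" using assms by (intro intrinsic_volume_pos)
next
  fix k assume Z: "bounded Z \<and> interior Z \<noteq> {}" and k: "k < CARD('n)"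
  then show "0 < intrinsic_volume Z k"
    using assms aff_dim_nonempty_interior[of Z] by (intro intrinsic_volume_pos) auto
  show "intrinsic_volume Z k < \<infinity>"
    using assms Z k by (intro intrinsic_volume_compact_finite) (auto simp: compact_eq_bounded_closed)
qed

end
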